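(* Let $r>0$ and let $(X_t)_{t\ge 0}$ be the Brownian motion with drift $X_t = X_0 + B_t - rt$, where $(B_t)_{t\ge0}$ is a standard one-dimensional Brownian motion started at $0$, independent of $X_0$. Let $\tau_0 := \inf\{t\ge 0: X_t = 0\}$. If the initial law $\mu$, a probability measure on $(0,+\infty)$, satisfies $$\int_0^\infty x^3 e^{rx}\,\mu(dx) < +\infty,$$ then $$0 < \liminf_{t\to\infty} t\,\mathcal{W}_1\big(\mathbb{P}_\mu[X_t\in\cdot\mid \tau_0>t],\alpha_{\mathrm{Yaglom}}\big) \le \limsup_{t\to\infty} t\,\mathcal{W}_1\big(\mathbb{P}_\mu[X_t\in\cdot\mid \tau_0>t],\alpha_{\mathrm{Yaglom}}\big) < +\infty,$$ where $\alpha_{\mathrm{Yaglom}}(dx) = r^2 x e^{-rx}\,dx$ on $(0,+\infty)$.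
   Context: $\mathbb{P}_\mu$ denotes the law of the process with $X_0\sim\mu$, and $\mathbb{P}_\mu(X_t\in\cdot\mid\tau_0>t) := \mathbb{P}_\mu(X_t\in\cdot,\tau_0>t)/\mathbb{P}_\mu(\tau_0>t)$. For probability measures $\mu,\nu$ on $(0,+\infty)$, the $1$-Wasserstein distance is defined as $\mathcal{W}_1(\mu,\nu) := \sup_{f\in \mathrm{Lip}_{1,1}(\mathbb{R}_+)} |\mu(f)-\nu(f)|$, where $\mathrm{Lip}_{1,1}(\mathbb{R}_+)$ is the set of $1$-Lipschitz functions $f$ on $\mathbb{R}_+$ with $f(0)=1$, and $\mu(f)=\int f\,d\mu$. *)

theory Defs
  imports "HOL-Probability.Probability"
begin

definition std_BM :: "'a measure \<Rightarrow> (real \<Rightarrow> 'a \<Rightarrow> real) \<Rightarrow> bool" where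
  "std_BM M B \<longleftrightarrow>
     prob_space M \<and>
     (\<forall>t. B t \<in> borel_measurable M) \<and>
     (\<forall>\<omega>\<in>space M. B 0 \<omega> = 0 \<and> continuous_on {0..} (\<lambda>t. B t \<omega>)) \<and>
     (\<forall>s t. 0 \<le> s \<and> s < t \<longrightarrow>
        distributed M lborel (\<lambda>\<omega>. B t \<omega> - B s \<omega>)
          (\<lambda>x. ennreal (normal_density 0 (sqrt (t - s)) x))) \<and>
     (\<forall>(ts :: nat \<Rightarrow> real) n. 0 \<le> ts 0 \<and> mono ts \<longrightarrow>
        prob_space.indep_vars M (\<lambda>_. borel)
          (\<lambda>i \<omega>. B (ts (Suc i)) \<omega> - B (ts i) \<omega>) {..<n})"

text \<open>Hitting time of 0: inf {t \<ge> 0. X t = 0} (with inf of the empty set = +\<infinity>).\<close>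
definition hit0 :: "(real \<Rightarrow> 'a \<Rightarrow> real) \<Rightarrow> 'a \<Rightarrow> ereal" where
  "hit0 X \<omega> = Inf {ereal t | t. 0 \<le> t \<and> X t \<omega> = 0}"

definition cond_law :: "'a measure \<Rightarrow> (real \<Rightarrow> 'a \<Rightarrow> real) \<Rightarrow> real \<Rightarrow> real measure" where
  "cond_law M X t =
     distr (uniform_measure M {\<omega> \<in> space M. hit0 X \<omega> > ereal t}) borel (X t)"

text \<open>1-Wasserstein distance as in the paper: sup over 1-Lipschitz f on R_+ with f 0 = 1
  (measurability is required so that the integrals make sense).\<close>
definition W1 :: "real measure \<Rightarrow> real measure \<Rightarrow> ereal" where
  "W1 \<mu> \<nu> = (SUP f \<in> {f :: real \<Rightarrow> real. f \<in> borel_measurable borel \<and> f 0 = 1 \<and>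
                   (\<forall>x y. 0 \<le> x \<longrightarrow> 0 \<le> y \<longrightarrow> \<bar>f x - f y\<bar> \<le> \<bar>x - y\<bar>)}.
               ereal \<bar>(\<integral>x. f x \<partial>\<mu>) - (\<integral>x. f x \<partial>\<nu>)\<bar>)"

definition yaglom :: "real \<Rightarrow> real measure" where
  "yaglom r = density lborel (\<lambda>x. ennreal (indicator {0<..} x * r\<^sup>2 * x * exp (- r * x)))"

end

theory Submission
  imports Defs "HOL-Real_Asymp.Real_Asymp"
begin

text \<open>
  For every \<open>\<theta>\<close> the process \<open>exp ((r\<^sup>2 + \<theta>\<^sup>2) t / 2) exp (r X\<^sub>t) sin (\<theta> X\<^sub>t)\<close> is a martingale that
  vanishes at the origin. Stopping it when the path, sampled on finer and finer dyadic grids, first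
  falls below a small level gives
  \<open>E[exp (r X\<^sub>t) sin (\<theta> X\<^sub>t); \<tau>\<^sub>0 > t] = exp (- (r\<^sup>2 + \<theta>\<^sup>2) t / 2) E[exp (r X\<^sub>0) sin (\<theta> X\<^sub>0)]\<close>, and a
  finite measure on the half-line is determined by its sine transform; this replaces the reflection
  principle and Girsanov's theorem. The conditional law therefore has a density with respect to the
  Yaglom limit proportional to \<open>E[X\<^sub>0 exp (r X\<^sub>0) K\<^sub>t(X\<^sub>0, y)]\<close>, where
  \<open>K\<^sub>t(x, y) = exp (- (x\<^sup>2 + y\<^sup>2) / 2t) sinh (xy/t) / (xy/t)\<close> satisfies
  \<open>0 \<le> t (1 - K\<^sub>t) \<le> (x\<^sup>2 + y\<^sup>2) / 2\<close>, with convergence to the right-hand side as \<open>t \<rightarrow> \<infinity>\<close>. This gives the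
  upper bound of order \<open>1/t\<close>; the test function \<open>1 + y\<close> alone already gives the limit \<open>6 / r\<^sup>3\<close> from below.
\<close>

section \<open>Gaussian exponential integrals\<close>

text \<open>Brownian motion enters only through independent Gaussian increments and continuous
  paths, so stopping is done on a grid, where the next step factorises from any event of the past.
  Two defects of the grid shape the argument. The sampled path may undershoot the level, so the
  martingale does not vanish at the stopping time; within distance e of the origin it is O(e), and a
  deeper undershoot needs a large step, which uniform continuity makes improbable. The path may also
  touch or cross zero between grid points; a strictly positive level rules this out once all dyadic
  points are controlled. Hence the order of limits: mesh to zero at a fixed level, then level to
  zero, which also avoids any discussion of paths that touch zero without crossing. The weight exp(r
  x) is forced: for c = a + i \<theta> one step multiplies exp(c X) in mean by exp(h (c^2/2 - r c)),
  and for nonzero \<theta> this exponent is real exactly when a = r. Only then does the imaginary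
  part, which vanishes at 0, evolve by itself.\<close>

lemma normal_density_iexp_integral:
  assumes s: "\<sigma> > 0"
  shows "(CLINT z|lborel. normal_density m \<sigma> z *\<^sub>R iexp (\<theta> * z))
    = iexp (\<theta> * m) * exp (- (\<theta> * \<sigma>)\<^sup>2 / 2)"
proof -
  have std: "(CLINT z|lborel. std_normal_density z *\<^sub>R iexp (s * z)) = exp (- s\<^sup>2 / 2)" for s
    using fun_cong[OF char_std_normal_distribution, of s]
    by (simp add: char_def integral_density)
  have "(CLINT z|lborel. normal_density m \<sigma> z *\<^sub>R iexp (\<theta> * z))
      = \<sigma> *\<^sub>R (CLINT z|lborel. normal_density m \<sigma> (m + \<sigma> * z) *\<^sub>R iexp (\<theta> * (m + \<sigma> * z)))"
    using s by (subst lborel_integral_real_affine[of \<sigma> _ m]) auto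
  also have "\<dots> = \<sigma> *\<^sub>R (CLINT z|lborel. iexp (\<theta> * m) / \<sigma> * (std_normal_density z *\<^sub>R iexp (\<theta> * \<sigma> * z)))"
    using s by (intro arg_cong[where f="\<lambda>x. \<sigma> *\<^sub>R x"] Bochner_Integration.integral_cong refl)
      (auto simp: normal_density_def real_sqrt_mult power_mult_distrib exp_add[symmetric]
         scaleR_conv_of_real algebra_simps)
  also have "\<dots> = iexp (\<theta> * m) * exp (- (\<theta> * \<sigma>)\<^sup>2 / 2)"
    using s std[of "\<theta> * \<sigma>"] by (simp add: scaleR_conv_of_real)
  finally show ?thesis .
qed

text \<open>Completing the square: an exponential weight only shifts the mean by
  \<open>r * \<sigma>\<^sup>2\<close>. This is the one-time form of a change of drift.\<close>

lemma normal_density_exp_tilt: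
  assumes "\<sigma> > 0"
  shows "exp (r * z) * normal_density m \<sigma> z = exp (r * m + r\<^sup>2 * \<sigma>\<^sup>2 / 2) * normal_density (m + r * \<sigma>\<^sup>2) \<sigma> z"
proof -
  have "r * z - (z - m)\<^sup>2 / (2 * \<sigma>\<^sup>2) = (r * m + r\<^sup>2 * \<sigma>\<^sup>2 / 2) - (z - (m + r * \<sigma>\<^sup>2))\<^sup>2 / (2 * \<sigma>\<^sup>2)"
    using assms by (simp add: field_simps power2_eq_square)
  then have "exp (r * z) * exp (- (z - m)\<^sup>2 / (2 * \<sigma>\<^sup>2)) = exp (r * m + r\<^sup>2 * \<sigma>\<^sup>2 / 2) * exp (- (z - (m + r * \<sigma>\<^sup>2))\<^sup>2 / (2 * \<sigma>\<^sup>2))"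
    by (simp add: exp_add[symmetric])
  then show ?thesis by (simp add: normal_density_def)
qed

lemma integrable_normal_density_exp:
  assumes "\<sigma> > 0"
  shows "integrable lborel (\<lambda>z. normal_density m \<sigma> z * exp (r * z))"
  using normal_density_exp_tilt[OF assms]
    integrable_mult_right[OF integrable_normal_density[OF assms], of "exp (r * m + r\<^sup>2 * \<sigma>\<^sup>2 / 2)" "m + r * \<sigma>\<^sup>2"]
  by (simp only: mult.commute[of _ "exp (r * _)"])

lemma integrable_normal_density_cexp:
  assumes "\<sigma> > 0"
  shows "integrable lborel (\<lambda>z. normal_density m \<sigma> z *\<^sub>R exp (c * complex_of_real z))"
  by (rule Bochner_Integration.integrable_bound[OF integrable_normal_density_exp[OF assms, of m "Re c"]])
     auto

text \<open>The tilt absorbs the real part of the exponent, so the characteristic function of the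
  shifted Gaussian suffices and no analytic continuation of the Laplace transform is needed.\<close>

lemma normal_density_cexp_integral:
  assumes "\<sigma> > 0"
  shows "(CLINT z|lborel. normal_density m \<sigma> z *\<^sub>R exp (Complex r \<theta> * z))
    = exp (Complex r \<theta> * m + (Complex r \<theta>)\<^sup>2 * \<sigma>\<^sup>2 / 2)"
proof -
  have "(CLINT z|lborel. normal_density m \<sigma> z *\<^sub>R exp (Complex r \<theta> * z))
      = (CLINT z|lborel. exp (r * m + r\<^sup>2 * \<sigma>\<^sup>2 / 2) *\<^sub>R (normal_density (m + r * \<sigma>\<^sup>2) \<sigma> z *\<^sub>R iexp (\<theta> * z)))"
  proof (intro Bochner_Integration.integral_cong refl)
    fix z :: real
    have "normal_density m \<sigma> z *\<^sub>R exp (Complex r \<theta> * z) = (exp (r * z) * normal_density m \<sigma> z) *\<^sub>R iexp (\<theta> * z)"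
      by (simp add: Complex_eq ring_distribs exp_add scaleR_conv_of_real exp_of_real[symmetric] mult_ac)
    then show "normal_density m \<sigma> z *\<^sub>R exp (Complex r \<theta> * z)
      = exp (r * m + r\<^sup>2 * \<sigma>\<^sup>2 / 2) *\<^sub>R (normal_density (m + r * \<sigma>\<^sup>2) \<sigma> z *\<^sub>R iexp (\<theta> * z))"
      by (simp add: normal_density_exp_tilt[OF assms])
  qed
  also have "\<dots> = exp (Complex r \<theta> * m + (Complex r \<theta>)\<^sup>2 * \<sigma>\<^sup>2 / 2)"
    by (simp only: integral_scaleR_right normal_density_iexp_integral[OF assms])
       (simp add: scaleR_conv_of_real exp_of_real[symmetric] mult_exp_exp Complex_eq power2_eq_square algebra_simps add_divide_distrib diff_divide_distrib)
  finally show ?thesis .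
qed

section \<open>Uniqueness of sine transforms\<close>

text \<open>A sine transform sees only the odd part of a measure, its difference with its reflection
  R. The signed identity N1 - R N1 = N2 - R N2 becomes, with sums instead of differences, N1 + R N2
  = N2 + R N1 between finite positive measures.\<close>

definition add_measure :: "'a measure \<Rightarrow> 'a measure \<Rightarrow> 'a measure" where
  "add_measure N1 N2 = measure_of (space N1) (sets N1) (\<lambda>A. emeasure N1 A + emeasure N2 A)"

lemma sets_add_measure [measurable_cong, simp]: "sets (add_measure N1 N2) = sets N1"
  by (simp add: add_measure_def)

lemma space_add_measure [simp]: "space (add_measure N1 N2) = space N1"
  by (simp add: add_measure_def)

lemma emeasure_add_measure:
  assumes s: "sets N2 = sets N1" and A: "A \<in> sets N1"
  shows "emeasure (add_measure N1 N2) A = emeasure N1 A + emeasure N2 A"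
  using A unfolding add_measure_def
proof (rule emeasure_measure_of_sigma[OF sets.sigma_algebra_axioms, rotated -1])
  show "countably_additive (sets N1) (\<lambda>A. emeasure N1 A + emeasure N2 A)"
    by (auto simp: countably_additive_def s suminf_add[symmetric] suminf_emeasure)
qed (simp add: positive_def)

lemma nn_integral_add_measure:
  assumes s: "sets N2 = sets N1" and f: "f \<in> borel_measurable N1"
  shows "(\<integral>\<^sup>+x. f x \<partial>add_measure N1 N2) = (\<integral>\<^sup>+x. f x \<partial>N1) + (\<integral>\<^sup>+x. f x \<partial>N2)"
  using f
proof (induction rule: borel_measurable_induct)
  case (cong f g)
  then show ?case
    using sets_eq_imp_space_eq[OF s] nn_integral_cong[of N1 f g] nn_integral_cong[of N2 f g]
      nn_integral_cong[of "add_measure N1 N2" f g] by simp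
next
  case (set A)
  then show ?case using s by (simp add: emeasure_add_measure)
next
  case (mult u c)
  then have "u \<in> borel_measurable N2" "u \<in> borel_measurable (add_measure N1 N2)"
    by (simp_all add: measurable_cong_sets[OF s refl] cong: measurable_cong_sets)
  with mult show ?case by (simp add: nn_integral_cmult distrib_left)
next
  case (add u v)
  then have "u \<in> borel_measurable N2" "u \<in> borel_measurable (add_measure N1 N2)"
     "v \<in> borel_measurable N2" "v \<in> borel_measurable (add_measure N1 N2)"
    by (simp_all add: measurable_cong_sets[OF s refl] cong: measurable_cong_sets)
  with add show ?case by (simp add: nn_integral_add add_ac)
next
  case (seq U)
  then have m: "\<And>i. U i \<in> borel_measurable N2" "\<And>i. U i \<in> borel_measurable (add_measure N1 N2)"
    by (simp_all add: measurable_cong_sets[OF s refl] cong: measurable_cong_sets)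
  have inc: "incseq (\<lambda>i. \<integral>\<^sup>+x. U i x \<partial>N1)" "incseq (\<lambda>i. \<integral>\<^sup>+x. U i x \<partial>N2)"
    using seq(4) by (auto simp: incseq_def le_fun_def intro!: nn_integral_mono le_funD[OF incseqD[OF seq(3)]])
  show ?case
    using seq m inc
    by (simp add: nn_integral_monotone_convergence_SUP image_comp
        ennreal_SUP_add[symmetric])
qed

lemma integrable_add_measure:
  fixes f :: "'a \<Rightarrow> 'b::{banach, second_countable_topology}"
  assumes s: "sets N2 = sets N1" and f: "integrable N1 f" "integrable N2 f"
  shows "integrable (add_measure N1 N2) f"
  using f s by (auto simp: integrable_iff_bounded nn_integral_add_measure cong: measurable_cong_sets)

lemma integral_add_measure_real:
  fixes f :: "'a \<Rightarrow> real"
  assumes s: "sets N2 = sets N1" and f: "integrable N1 f" "integrable N2 f"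
  shows "(\<integral>x. f x \<partial>add_measure N1 N2) = (\<integral>x. f x \<partial>N1) + (\<integral>x. f x \<partial>N2)"
proof -
  have m[measurable]: "f \<in> borel_measurable N1" using f by auto
  have fin: "(\<integral>\<^sup>+x. ennreal (f x) \<partial>N) < \<infinity>" "(\<integral>\<^sup>+x. ennreal (- f x) \<partial>N) < \<infinity>" if "integrable N f" for N
    using that by (auto simp: real_integrable_def top.not_eq_extremum)
  show ?thesis
    using fin[OF f(1)] fin[OF f(2)]
    by (simp add: real_lebesgue_integral_def integrable_add_measure[OF s f] f nn_integral_add_measure[OF s] enn2real_plus)
qed

lemma integral_add_measure_complex:
  fixes f :: "'a \<Rightarrow> complex"
  assumes s: "sets N2 = sets N1" and f: "integrable N1 f" "integrable N2 f"
  shows "(\<integral>x. f x \<partial>add_measure N1 N2) = (\<integral>x. f x \<partial>N1) + (\<integral>x. f x \<partial>N2)"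
  using integral_add_measure_real[OF s, of "\<lambda>x. Re (f x)"] integral_add_measure_real[OF s, of "\<lambda>x. Im (f x)"] f
  by (intro complex_eqI) (simp_all add: integrable_add_measure[OF s f])

text \<open>Levy's theorem speaks of probability laws. The characteristic functions at 0 show that
  both masses are equal, so both measures are normalised by the same constant; mass zero is treated
  separately.\<close>

lemma finite_measure_char_unique:
  assumes "finite_measure N1" "finite_measure N2"
    and s1: "sets N1 = sets borel" and s2: "sets N2 = sets borel"
    and c: "\<And>\<theta>. char N1 \<theta> = char N2 \<theta>"
  shows "N1 = N2"
proof -
  interpret N1: finite_measure N1 by fact
  interpret N2: finite_measure N2 by fact
  have sp: "space N1 = UNIV" "space N2 = UNIV"
    using s1 s2 by (auto dest: sets_eq_imp_space_eq)
  define m where "m = measure N1 UNIV"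
  have m: "measure N2 UNIV = m"
    using c[of 0] by (simp add: char_def sp m_def)
  have e: "emeasure N1 UNIV = m" "emeasure N2 UNIV = m"
    using m m_def N1.emeasure_eq_measure N2.emeasure_eq_measure by simp_all
  show ?thesis
  proof (cases "m = 0")
    case True
    then have "emeasure N1 A = 0" "emeasure N2 A = 0" for A
      using e sp by (metis emeasure_space ennreal_0 le_zero_eq)+
    then show ?thesis using s1 s2 by (intro measure_eqI) auto
  next
    case False
    then have mp: "m > 0" using m_def by (simp add: less_le)
    have P: "real_distribution (scale_measure (ennreal (1/m)) N)"
      if "sets N = sets borel" "emeasure N UNIV = m" for N
    proof -
      have "space N = UNIV" using sets_eq_imp_space_eq[OF that(1)] by simp
      then show ?thesis
      using that mp by (auto simp: real_distribution_def real_distribution_axioms_def ennreal_mult[symmetric] space_scale_measure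
          intro!: prob_spaceI)
    qed
    have ch: "char (scale_measure (ennreal (1/m)) N) \<theta> = char N \<theta> / m" if "sets N = sets borel" for N \<theta>
    proof -
      have "scale_measure (ennreal (1/m)) N = density N (\<lambda>_. ennreal (1/m))"
        by (rule measure_eqI) (simp_all add: emeasure_density nn_integral_cmult)
      moreover have "(\<lambda>z. iexp (\<theta> * z)) \<in> borel_measurable N"
        unfolding measurable_cong_sets[OF that refl] by measurable
      ultimately show ?thesis using mp by (simp add: char_def integral_density scaleR_conv_of_real)
    qed
    have "scale_measure (ennreal (1/m)) N1 = scale_measure (ennreal (1/m)) N2"
      by (rule Levy_uniqueness[OF P P]) (auto simp: s1 s2 e ch c)
    then have "scale_measure (ennreal m) (scale_measure (ennreal (1/m)) N1)
       = scale_measure (ennreal m) (scale_measure (ennreal (1/m)) N2)" by simp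
    then show ?thesis using mp by (simp add: scale_scale_measure ennreal_mult[symmetric])
  qed
qed

text \<open>Adding to each measure the reflection of the other one makes the real parts of the
  characteristic functions agree for free; the sine transforms are the imaginary parts.\<close>

lemma finite_measure_sin_unique:
  fixes N1 N2 :: "real measure"
  assumes f1: "finite_measure N1" and f2: "finite_measure N2"
    and s1: "sets N1 = sets borel" and s2: "sets N2 = sets borel"
    and p1: "emeasure N1 {..0} = 0" and p2: "emeasure N2 {..0} = 0"
    and sine: "\<And>\<theta>. (\<integral>y. sin (\<theta> * y) \<partial>N1) = (\<integral>y. sin (\<theta> * y) \<partial>N2)"
  shows "N1 = N2"
proof -
  define R where "R N = distr N borel (uminus :: real \<Rightarrow> real)" for N
  have um: "(uminus :: real \<Rightarrow> real) \<in> measurable N borel" if "sets N = sets borel" for N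
    unfolding measurable_cong_sets[OF that refl] by measurable
  have sR[simp]: "sets (R N) = sets borel" for N by (simp add: R_def)
  have int: "integrable N (\<lambda>z. iexp (\<theta> * z))" if "finite_measure N" "sets N = sets borel" for \<theta> N
  proof -
    interpret finite_measure N by fact
    have [measurable]: "(\<lambda>z. iexp (\<theta> * z)) \<in> borel_measurable N"
      unfolding measurable_cong_sets[OF that(2) refl] by measurable
    show ?thesis by (rule integrable_const_bound[of _ 1]) (auto simp del: of_real_mult)
  qed
  have fR: "finite_measure (R N)" if "finite_measure N" "sets N = sets borel" for N
    unfolding R_def by (rule finite_measure.finite_measure_distr[OF that(1) um[OF that(2)]])
  have fin: "finite_measure (add_measure N N')" if "finite_measure N" "sets N = sets borel"
    "finite_measure N'" "sets N' = sets borel" for N N'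
  proof -
    have "emeasure (add_measure N N') (space N) = emeasure N (space N) + emeasure N' (space N)"
      using that by (intro emeasure_add_measure) auto
    then show ?thesis
      using that by (intro finite_measureI) (auto simp: finite_measure.emeasure_finite)
  qed
  have Rch: "char (R N) \<theta> = cnj (char N \<theta>)" if "sets N = sets borel" "finite_measure N" for N \<theta>
  proof -
    have "char (R N) \<theta> = (\<integral>z. iexp (\<theta> * - z) \<partial>N)"
      unfolding char_def R_def using um[OF that(1)] by (subst integral_distr) auto
    also have "\<dots> = (\<integral>z. cnj (iexp (\<theta> * z)) \<partial>N)"
      by (simp add: exp_cnj)
    finally show ?thesis unfolding char_def by simp
  qed
  have Im: "Im (char N \<theta>) = (\<integral>y. sin (\<theta> * y) \<partial>N)" if "sets N = sets borel" "finite_measure N" for N \<theta>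
    unfolding char_def using int[OF that(2,1)] by (subst integral_Im[symmetric]) (auto simp: Im_exp)
  have ach: "char (add_measure N N') \<theta> = char N \<theta> + char N' \<theta>"
    if "finite_measure N" "sets N = sets borel" "finite_measure N'" "sets N' = sets borel" for N N' \<theta>
    unfolding char_def by (intro integral_add_measure_complex int that) (simp add: that)
  have "add_measure N1 (R N2) = add_measure N2 (R N1)"
  proof (rule finite_measure_char_unique)
    fix \<theta>
    have "Im (char N1 \<theta>) = Im (char N2 \<theta>)" using sine by (simp add: Im s1 s2 f1 f2)
    then show "char (add_measure N1 (R N2)) \<theta> = char (add_measure N2 (R N1)) \<theta>"
      by (simp add: ach f1 f2 s1 s2 fR Rch complex_eq_iff)
  qed (auto intro!: fin fR f1 f2 simp: s1 s2)
  then have eq: "emeasure (add_measure N1 (R N2)) A = emeasure (add_measure N2 (R N1)) A" for A by simp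
  \<comment> \<open>The reflections carry no mass on the positive half-line, so the identity of sums
    restricts there to \<open>N1\<close> against \<open>N2\<close>.\<close>
  have R0: "emeasure (R N) A = 0" if "sets N = sets borel" "emeasure N {..0} = 0" "A \<in> sets borel" "A \<subseteq> {0<..}" for N A
  proof -
    have "emeasure (R N) A = emeasure N (uminus -` A \<inter> space N)"
      unfolding R_def using um[OF that(1)] that(3) by (rule emeasure_distr)
    also have "\<dots> \<le> emeasure N {..0}"
      using that by (intro emeasure_mono) auto
    finally show ?thesis using that by simp
  qed
  show ?thesis
  proof (rule measure_eqI)
    fix A assume "A \<in> sets N1"
    then have A: "A \<in> sets borel" by (simp add: s1)
    have split: "emeasure N A = emeasure N (A \<inter> {0<..})" if "sets N = sets borel" "emeasure N {..0} = 0" for N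
    proof -
      have "AE x in N. x \<notin> {..0}"
        using that by (intro AE_not_in) (auto simp: null_sets_def)
      then show ?thesis using that A by (intro emeasure_eq_AE) auto
    qed
    have "emeasure N1 (A \<inter> {0<..}) = emeasure N2 (A \<inter> {0<..})"
      using eq[of "A \<inter> {0<..}"] A
      by (simp add: emeasure_add_measure s1 s2 R0 p1 p2)
    then show "emeasure N1 A = emeasure N2 A" by (simp add: split s1 s2 p1 p2)
  qed (simp add: s1 s2)
qed

section \<open>Paths on dyadic grids and the hitting time\<close>

text \<open>Density of dyadic points plus continuity. Only the non-strict bound passes to the limit,
  which is harmless as long as \<open>a\<close> is strictly positive in the applications.\<close>

lemma grid_dense:
  fixes f :: "real \<Rightarrow> real"
  assumes t: "t > 0" and cont: "continuous_on {0..t} f"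
    and grid: "\<And>m k. k \<le> (2::nat) ^ m \<Longrightarrow> a \<le> f (real k * (t / 2 ^ m))"
    and s: "s \<in> {0..t}"
  shows "a \<le> f s"
proof -
  \<comment> \<open>The last grid point of level \<open>m\<close> that does not exceed
    \<open>s\<close>.\<close>
  define d where "d m = real (nat \<lfloor>s * 2 ^ m / t\<rfloor>) * (t / 2 ^ m)" for m :: nat
  have fl: "nat \<lfloor>s * 2 ^ m / t\<rfloor> \<le> 2 ^ m" for m
  proof -
    have "s * 2 ^ m / t \<le> 2 ^ m" using s t by (simp add: field_simps)
    then have "\<lfloor>s * 2 ^ m / t\<rfloor> \<le> \<lfloor>(2::real) ^ m\<rfloor>" by (rule floor_mono)
    also have "\<lfloor>(2::real) ^ m\<rfloor> = 2 ^ m" by (metis floor_of_int of_int_numeral of_int_power)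
    finally show ?thesis by (simp add: nat_le_iff)
  qed
  have d: "s - t / 2 ^ m \<le> d m" "d m \<le> s" for m
  proof -
    have nn: "0 \<le> s * 2 ^ m / t" using s t by auto
    then have eq: "real (nat \<lfloor>s * 2 ^ m / t\<rfloor>) = of_int \<lfloor>s * 2 ^ m / t\<rfloor>" by simp
    have "s * 2 ^ m / t - 1 \<le> real (nat \<lfloor>s * 2 ^ m / t\<rfloor>)" "real (nat \<lfloor>s * 2 ^ m / t\<rfloor>) \<le> s * 2 ^ m / t"
      unfolding eq by linarith+
    from this[THEN mult_right_mono, of "t / 2 ^ m"]
    have "(s * 2 ^ m / t - 1) * (t / 2 ^ m) \<le> d m" "d m \<le> (s * 2 ^ m / t) * (t / 2 ^ m)"
      unfolding d_def using t by simp_all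
    moreover have "(s * 2 ^ m / t - 1) * (t / 2 ^ m) = s - t / 2 ^ m" "(s * 2 ^ m / t) * (t / 2 ^ m) = s"
      using t by (simp_all add: field_simps)
    ultimately show "s - t / 2 ^ m \<le> d m" "d m \<le> s" by simp_all
  qed
  have "(\<lambda>m. s - t * (1 / 2) ^ m) \<longlonglongrightarrow> s - t * 0"
    by (intro tendsto_intros LIMSEQ_realpow_zero) auto
  then have "(\<lambda>m. s - t / 2 ^ m) \<longlonglongrightarrow> s" by (simp add: power_one_over)
  then have lim: "d \<longlonglongrightarrow> s"
    by (rule tendsto_sandwich[rotated 2]) (use d in auto)
  have d_mem: "d m \<in> {0..t}" for m
    using d(2)[of m] s t by (auto simp: d_def)
  have "(\<lambda>m. f (d m)) \<longlonglongrightarrow> f s"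
    using cont s lim d_mem unfolding continuous_on_sequentially by (auto simp: o_def)
  then show ?thesis
    by (rule LIMSEQ_le_const) (use grid fl in \<open>auto simp: d_def\<close>)
qed

text \<open>Uniform continuity on a compact interval. Applied to single paths, it makes large grid
  steps disappear as the mesh is refined.\<close>

lemma grid_osc_eventually:
  fixes f :: "real \<Rightarrow> real"
  assumes t: "t > 0" and cont: "continuous_on {0..t} f" and e: "\<epsilon> > 0"
  shows "\<forall>\<^sub>F m in sequentially. \<forall>k < (2::nat) ^ m. \<bar>f (real k * (t / 2 ^ m)) - f (real (Suc k) * (t / 2 ^ m))\<bar> < \<epsilon>"
proof -
  have "uniformly_continuous_on {0..t} f"
    using cont by (intro compact_uniformly_continuous) auto
  then obtain d where d: "d > 0" "\<And>x y. x \<in> {0..t} \<Longrightarrow> y \<in> {0..t} \<Longrightarrow> \<bar>x - y\<bar> < d \<Longrightarrow> \<bar>f x - f y\<bar> < \<epsilon>"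
    unfolding uniformly_continuous_on_def dist_real_def using e by metis
  have "(\<lambda>m. t * (1 / 2) ^ m) \<longlonglongrightarrow> t * 0"
    by (intro tendsto_intros LIMSEQ_realpow_zero) auto
  then have "\<forall>\<^sub>F m in sequentially. t * (1/2) ^ m < d"
    using d(1) by (simp add: order_tendstoD)
  then show ?thesis
  proof (rule eventually_mono, intro allI impI)
    fix m k assume m: "t * (1/2) ^ m < d" and k: "k < (2::nat) ^ m"
    have "real (Suc k) \<le> 2 ^ m" using k by (metis Suc_leI of_nat_le_iff of_nat_numeral of_nat_power)
    then have le: "real (Suc k) * (t / 2 ^ m) \<le> 2 ^ m * (t / 2 ^ m)"
      using t by (intro mult_right_mono) auto
    have "real k * (t / 2 ^ m) \<le> real (Suc k) * (t / 2 ^ m)"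
      using t by (intro mult_right_mono) auto
    then have "real k * (t / 2 ^ m) \<in> {0..t}" "real (Suc k) * (t / 2 ^ m) \<in> {0..t}"
      using le t by auto
    moreover have "\<bar>real k * (t / 2 ^ m) - real (Suc k) * (t / 2 ^ m)\<bar> < d"
      using m t by (simp add: distrib_right power_one_over add_divide_distrib)
    ultimately show "\<bar>f (real k * (t / 2 ^ m)) - f (real (Suc k) * (t / 2 ^ m))\<bar> < \<epsilon>"
      by (rule d(2))
  qed
qed

lemma interval_pos_lower:
  fixes f :: "real \<Rightarrow> real"
  assumes "0 \<le> t" "continuous_on {0..t} f" "\<And>s. s \<in> {0..t} \<Longrightarrow> 0 < f s"
  obtains a where "a > 0" "\<And>s. s \<in> {0..t} \<Longrightarrow> a \<le> f s"
proof -
  have "\<exists>x\<in>{0..t}. \<forall>y\<in>{0..t}. f x \<le> f y"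
    by (rule continuous_attains_inf) (use assms in auto)
  then show thesis using assms(3) that by blast
qed

lemma grid_mem:
  assumes "t > 0" "k \<le> (2::nat) ^ m"
  shows "real k * (t / 2 ^ m) \<in> {0..t}"
proof -
  have "real k * (t / 2 ^ m) \<le> 2 ^ m * (t / 2 ^ m)"
    using assms by (intro mult_right_mono) (auto simp: numeral_power_le_of_nat_cancel_iff of_nat_le_numeral_power_cancel_iff)
  then show ?thesis using assms by simp
qed

text \<open>Absence of zeros on \<open>{0..t}\<close> alone would give only
  \<open>hit0 X \<omega>\<close> at least \<open>t\<close>. Continuity at \<open>t\<close> adds a
  zero-free window of length \<open>d\<close> to the right, and the infimum is then at least
  \<open>t + d\<close>.\<close>

lemma hit0_gt_iff:
  assumes t: "0 \<le> t" and cont: "continuous_on {0..} (\<lambda>s. X s \<omega>)"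
  shows "ereal t < hit0 X \<omega> \<longleftrightarrow> (\<forall>s\<in>{0..t}. X s \<omega> \<noteq> 0)"
proof
  assume hit: "ereal t < hit0 X \<omega>"
  show "\<forall>s\<in>{0..t}. X s \<omega> \<noteq> 0"
  proof (intro ballI notI)
    fix s assume s: "s \<in> {0..t}" "X s \<omega> = 0"
    then have "hit0 X \<omega> \<le> ereal s" unfolding hit0_def by (intro Inf_lower) auto
    also have "\<dots> \<le> ereal t" using s by simp
    finally show False using hit by simp
  qed
next
  assume nz: "\<forall>s\<in>{0..t}. X s \<omega> \<noteq> 0"
  then have "0 < \<bar>X t \<omega>\<bar>" using t by auto
  then obtain d where d: "d > 0" "\<And>s. s \<in> {0..} \<Longrightarrow> \<bar>s - t\<bar> < d \<Longrightarrow> \<bar>X s \<omega> - X t \<omega>\<bar> < \<bar>X t \<omega>\<bar>"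
    using cont t unfolding continuous_on_iff dist_real_def by (metis atLeast_iff)
  have "t + d \<le> s" if "0 \<le> s" "X s \<omega> = 0" for s
    using d(2)[of s] nz that t by (cases "s \<le> t") force+
  then have "ereal (t + d) \<le> hit0 X \<omega>"
    unfolding hit0_def by (intro Inf_greatest) auto
  moreover have "ereal t < ereal (t + d)" using d by simp
  ultimately show "ereal t < hit0 X \<omega>" by (rule less_le_trans[rotated])
qed

section \<open>The stopped martingale\<close>

text \<open>The exponential moment alone carries the identification of the killed law, as it
  dominates every martingale used. The cubic moment is added in \<open>yaglom_bm\<close>, for the
  rate.\<close>

locale drifted_bm = prob_space M for M :: "'a measure" +
  fixes B :: "real \<Rightarrow> 'a \<Rightarrow> real" and X0 :: "'a \<Rightarrow> real" and r :: real
  assumes r: "r > 0"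
    and BM: "std_BM M B"
    and X0_meas [measurable]: "X0 \<in> borel_measurable M"
    and X0_pos: "AE \<omega> in M. 0 < X0 \<omega>"
    and X0_exp: "integrable M (\<lambda>\<omega>. exp (r * X0 \<omega>))"
    and indep: "indep_set (sets (vimage_algebra (space M) X0 borel))
                  (sets (vimage_algebra (space M) (\<lambda>\<omega> t. B t \<omega>) (PiM UNIV (\<lambda>_. borel))))"
begin

section \<open>The process and its increments along a grid\<close>

definition X :: "real \<Rightarrow> 'a \<Rightarrow> real" where
  "X t \<omega> = X0 \<omega> + B t \<omega> - r * t"

lemma B_meas [measurable]: "B t \<in> borel_measurable M"
  and B_0: "\<omega> \<in> space M \<Longrightarrow> B 0 \<omega> = 0"
  and B_cont: "\<omega> \<in> space M \<Longrightarrow> continuous_on {0..} (\<lambda>t. B t \<omega>)"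
  and B_distr: "0 \<le> s \<Longrightarrow> s < t \<Longrightarrow> distributed M lborel (\<lambda>\<omega>. B t \<omega> - B s \<omega>)
          (\<lambda>x. ennreal (normal_density 0 (sqrt (t - s)) x))"
  and B_indep: "0 \<le> ts 0 \<Longrightarrow> mono ts \<Longrightarrow> indep_vars (\<lambda>_. borel)
          (\<lambda>i \<omega>. B (ts (Suc i)) \<omega> - B (ts i) \<omega>) {..<n}"
  using BM unfolding std_BM_def by auto

lemma X_meas [measurable]: "X t \<in> borel_measurable M"
  unfolding X_def by measurable

lemma X_cont: "\<omega> \<in> space M \<Longrightarrow> continuous_on {0..} (\<lambda>t. X t \<omega>)"
  unfolding X_def by (intro continuous_intros B_cont)

lemma X_cont_interval: "\<omega> \<in> space M \<Longrightarrow> continuous_on {0..t} (\<lambda>t. X t \<omega>)"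
  by (rule continuous_on_subset[OF X_cont]) auto

lemma X_0: "\<omega> \<in> space M \<Longrightarrow> X 0 \<omega> = X0 \<omega>"
  by (simp add: X_def B_0)

text \<open>Entry 0 of the sequence of increments is the initial value.\<close>

definition incr :: "real \<Rightarrow> nat \<Rightarrow> 'a \<Rightarrow> real" where
  "incr h i \<omega> = (case i of 0 \<Rightarrow> X0 \<omega> | Suc i \<Rightarrow> B (real (Suc i) * h) \<omega> - B (real i * h) \<omega>)"

lemma incr_0: "incr h 0 = X0"
  by (auto simp: incr_def)

lemma incr_Suc: "incr h (Suc i) = (\<lambda>\<omega>. B (real (Suc i) * h) \<omega> - B (real i * h) \<omega>)"
  by (auto simp: incr_def)

lemma incr_meas [measurable]: "incr h i \<in> borel_measurable M"
  unfolding incr_def by (cases i) simp_all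

text \<open>Two sources of independence are merged: the increments among themselves, and
  \<open>X0\<close> from the whole path of \<open>B\<close>. Index 0 is split off from
  \<open>J\<close>, and \<open>J'\<close> holds the remaining indices shifted down by one.\<close>

lemma indep_incr:
  assumes h: "h > 0"
  shows "indep_vars (\<lambda>_. borel) (incr h) {..n}"
  unfolding indep_vars_def2
proof (intro conjI ballI indep_setsI)
  fix A J assume J: "J \<noteq> {}" "J \<subseteq> {..n}" "finite J"
    and A: "\<forall>j\<in>J. A j \<in> {incr h j -` S \<inter> space M |S. S \<in> sets borel}"
  have mono: "mono (\<lambda>i. real i * h)" using h by (auto simp: mono_def intro!: mult_right_mono)
  let ?D = "\<lambda>i \<omega>. B (real (Suc i) * h) \<omega> - B (real i * h) \<omega>"
  let ?VB = "vimage_algebra (space M) (\<lambda>\<omega> t. B t \<omega>) (PiM UNIV (\<lambda>_. borel))"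
  have iD: "indep_sets (\<lambda>i. {?D i -` S \<inter> space M |S. S \<in> sets borel}) {..<n}"
    using B_indep[of "\<lambda>i. real i * h", OF _ mono] unfolding indep_vars_def2 by auto
  have Bmeas: "(\<lambda>\<omega>. B t \<omega>) \<in> borel_measurable ?VB" for t
  proof -
    have "(\<lambda>\<omega> t. B t \<omega>) \<in> measurable ?VB (PiM UNIV (\<lambda>_. borel))"
      by (rule measurable_vimage_algebra1) (auto simp: space_PiM)
    from measurable_compose[OF this measurable_component_singleton[of t UNIV]] show ?thesis by simp
  qed
  define J' where "J' = {i. Suc i \<in> J}"
  have fin': "finite J'" unfolding J'_def using J(3) finite_vimageI[of J Suc] by (simp add: vimage_def)
  have J'_sub: "J' \<subseteq> {..<n}" unfolding J'_def using J(2) by auto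
  have A': "A (Suc i) \<in> {?D i -` S \<inter> space M |S. S \<in> sets borel}" if "i \<in> J'" for i
    using A[rule_format, of "Suc i"] that unfolding J'_def incr_Suc by auto
  have VB: "A (Suc i) \<in> sets ?VB" if "i \<in> J'" for i
  proof -
    from A'[OF that] obtain S where S: "A (Suc i) = ?D i -` S \<inter> space M" "S \<in> sets borel" by blast
    have "?D i \<in> borel_measurable ?VB" by (intro borel_measurable_diff Bmeas)
    from measurable_sets[OF this S(2)] show ?thesis using S(1) by simp
  qed
  have prod': "prob (\<Inter>i\<in>J'. A (Suc i)) = (\<Prod>i\<in>J'. prob (A (Suc i)))" if "J' \<noteq> {}"
    using indep_setsD[OF iD J'_sub that fin', of "\<lambda>i. A (Suc i)"] A' by blast
  have J_eq: "J - {0} = Suc ` J'"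
    unfolding J'_def by (auto simp: image_iff) (metis not0_implies_Suc)
  have reindex: "(\<Inter>j\<in>J - {0}. A j) = (\<Inter>i\<in>J'. A (Suc i))" "(\<Prod>j\<in>J - {0}. prob (A j)) = (\<Prod>i\<in>J'. prob (A (Suc i)))"
    unfolding J_eq by (simp_all add: prod.reindex)
  show "prob (\<Inter>j\<in>J. A j) = (\<Prod>j\<in>J. prob (A j))"
  proof (cases "0 \<in> J")
    case False
    then have "J' \<noteq> {}" using J(1) J_eq by auto
    with False reindex prod' show ?thesis by simp
  next
    case True
    show ?thesis
    proof (cases "J' = {}")
      case empty: True
      then have "J = {0}" using J_eq True by auto
      then show ?thesis by simp
    next
      case False
      have A0: "A 0 \<in> sets (vimage_algebra (space M) X0 borel)"
        using A[rule_format, OF True] unfolding incr_0 by (auto simp: sets_vimage_algebra2)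
      have "(\<Inter>i\<in>J'. A (Suc i)) \<in> sets ?VB"
        using False fin' VB by (intro sets.finite_INT) auto
      from indep_setD[OF indep A0 this] have "prob (A 0 \<inter> (\<Inter>j\<in>J - {0}. A j)) = prob (A 0) * (\<Prod>j\<in>J - {0}. prob (A j))"
        using prod'[OF False] reindex by simp
      moreover have "A 0 \<inter> (\<Inter>j\<in>J - {0}. A j) = (\<Inter>j\<in>J. A j)" using True by auto
      ultimately show ?thesis using True J(3) by (simp add: prod.remove)
    qed
  qed
qed auto

lemma incr_cexp:
  fixes c :: complex
  assumes h: "h > 0"
  shows "integrable M (\<lambda>\<omega>. exp (c * complex_of_real (incr h (Suc k) \<omega>)))"
    and "(CLINT \<omega>|M. exp (c * complex_of_real (incr h (Suc k) \<omega>))) = exp (h * c\<^sup>2 / 2)"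
proof -
  let ?f = "\<lambda>x. normal_density 0 (sqrt h) x" and ?D = "incr h (Suc k)"
  have "distributed M lborel ?D ?f"
    using B_distr[of "real k * h" "real (Suc k) * h"] h
    by (simp add: incr_Suc algebra_simps)
  from distributed_distr_eq_density[OF this] have d: "distr M lborel ?D = density lborel (\<lambda>x. ennreal (?f x))" .
  have m: "?D \<in> measurable M lborel" by simp
  have "integrable (distr M lborel ?D) (\<lambda>x. exp (c * complex_of_real x))"
    unfolding d using integrable_normal_density_cexp[of "sqrt h" 0 c] h by (subst integrable_density) auto
  then show "integrable M (\<lambda>\<omega>. exp (c * complex_of_real (?D \<omega>)))"
    using m by (subst (asm) integrable_distr_eq) auto
  have "(CLINT \<omega>|M. exp (c * complex_of_real (?D \<omega>))) = (CLINT x|distr M lborel ?D. exp (c * complex_of_real x))"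
    using m by (subst integral_distr) auto
  also have "\<dots> = exp (h * c\<^sup>2 / 2)"
    unfolding d using normal_density_cexp_integral[of "sqrt h" 0 "Re c" "Im c"] h
    by (subst integral_density) (auto simp: mult.commute)
  finally show "(CLINT \<omega>|M. exp (c * complex_of_real (?D \<omega>))) = exp (h * c\<^sup>2 / 2)" .
qed

text \<open>The martingale property in the only form used: whatever the first \<open>k + 1\<close>
  coordinates determine is multiplied in mean by the Gaussian factor of the next step. Conditional
  expectations are thereby avoided.\<close>

lemma past_times_incr:
  fixes \<phi> :: "(nat \<Rightarrow> real) \<Rightarrow> complex" and c :: complex
  assumes h: "h > 0" and \<phi>: "\<phi> \<in> borel_measurable (PiM {..k} (\<lambda>_. borel))"
    and int: "integrable M (\<lambda>\<omega>. \<phi> (\<lambda>i\<in>{..k}. incr h i \<omega>))"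
  shows "integrable M (\<lambda>\<omega>. \<phi> (\<lambda>i\<in>{..k}. incr h i \<omega>) * exp (c * complex_of_real (incr h (Suc k) \<omega>)))"
    and "(CLINT \<omega>|M. \<phi> (\<lambda>i\<in>{..k}. incr h i \<omega>) * exp (c * complex_of_real (incr h (Suc k) \<omega>)))
      = (CLINT \<omega>|M. \<phi> (\<lambda>i\<in>{..k}. incr h i \<omega>)) * exp (h * c\<^sup>2 / 2)"
proof -
  have "indep_var (PiM {..k} (\<lambda>_. borel)) (\<lambda>\<omega>. \<lambda>i\<in>{..k}. incr h i \<omega>)
      (PiM {Suc k} (\<lambda>_. borel)) (\<lambda>\<omega>. \<lambda>i\<in>{Suc k}. incr h i \<omega>)"
    by (rule indep_var_restrict[OF indep_incr[OF h, of "Suc k"]]) auto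
  from indep_var_compose[OF this \<phi>, of "\<lambda>w. exp (c * complex_of_real (w (Suc k)))" borel]
  have iv: "indep_var borel (\<lambda>\<omega>. \<phi> (\<lambda>i\<in>{..k}. incr h i \<omega>)) borel (\<lambda>\<omega>. exp (c * complex_of_real (incr h (Suc k) \<omega>)))"
    by (simp add: o_def)
  show "integrable M (\<lambda>\<omega>. \<phi> (\<lambda>i\<in>{..k}. incr h i \<omega>) * exp (c * complex_of_real (incr h (Suc k) \<omega>)))"
    by (rule indep_var_integrable[OF iv int incr_cexp(1)[OF h]])
  show "(CLINT \<omega>|M. \<phi> (\<lambda>i\<in>{..k}. incr h i \<omega>) * exp (c * complex_of_real (incr h (Suc k) \<omega>)))
      = (CLINT \<omega>|M. \<phi> (\<lambda>i\<in>{..k}. incr h i \<omega>)) * exp (h * c\<^sup>2 / 2)"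
    by (subst indep_var_lebesgue_integral[OF iv int incr_cexp(1)[OF h]]) (simp add: incr_cexp(2)[OF h])
qed

text \<open>Rebuilds the grid values of \<open>X\<close> from a finite tuple of increments, so that
  events of the past become measurable sets in the product space required by
  \<open>past_times_incr\<close>.\<close>

definition path_of :: "real \<Rightarrow> (nat \<Rightarrow> real) \<Rightarrow> nat \<Rightarrow> real" where
  "path_of h w k = w 0 + (\<Sum>i<k. w (Suc i)) - r * (real k * h)"

lemma path_of_incr:
  assumes "\<omega> \<in> space M" "j \<le> k"
  shows "path_of h (\<lambda>i\<in>{..k}. incr h i \<omega>) j = X (real j * h) \<omega>"
proof -
  have "(\<Sum>i<j. incr h (Suc i) \<omega>) = B (real j * h) \<omega> - B (real 0 * h) \<omega>"
    unfolding incr_def by (simp add: sum_lessThan_telescope[of "\<lambda>i. B (real i * h) \<omega>" j] del: of_nat_Suc)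
  moreover have "(\<Sum>i<j. (\<lambda>i\<in>{..k}. incr h i \<omega>) (Suc i)) = (\<Sum>i<j. incr h (Suc i) \<omega>)"
    using assms(2) by (intro sum.cong) auto
  ultimately show ?thesis using assms by (simp add: path_of_def X_def B_0 incr_def)
qed

lemma path_of_meas [measurable]: "j \<le> k \<Longrightarrow> (\<lambda>w. path_of h w j) \<in> borel_measurable (PiM {..k} (\<lambda>_. borel))"
  unfolding path_of_def by (intro borel_measurable_add borel_measurable_diff borel_measurable_sum
     measurable_component_singleton borel_measurable_const) auto

lemma X_step:
  "X (real (Suc k) * h) \<omega> = X (real k * h) \<omega> + incr h (Suc k) \<omega> - r * h"
  by (simp add: X_def incr_def algebra_simps)

text \<open>Since \<open>Re c = r\<close>, the modulus at time 0 is
  \<open>exp (r * X0 \<omega>)\<close>, which is integrable by assumption; each step then multiplies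
  by an independent integrable factor.\<close>

lemma X_cexp_integrable:
  fixes c :: complex
  assumes h: "h > 0" and c: "Re c = r"
  shows "integrable M (\<lambda>\<omega>. exp (c * complex_of_real (X (real k * h) \<omega>)))"
proof (induction k)
  case 0
  have "integrable M (\<lambda>\<omega>. exp (c * complex_of_real (X0 \<omega>)))"
    by (rule Bochner_Integration.integrable_bound[OF X0_exp]) (auto simp: c)
  then show ?case by (simp add: X_0 cong: Bochner_Integration.integrable_cong)
next
  case (Suc k)
  let ?\<phi> = "\<lambda>w. exp (c * complex_of_real (path_of h w k))"
  have i: "integrable M (\<lambda>\<omega>. ?\<phi> (\<lambda>i\<in>{..k}. incr h i \<omega>))"
    using Suc by (simp add: path_of_incr cong: Bochner_Integration.integrable_cong)
  have m: "?\<phi> \<in> borel_measurable (PiM {..k} (\<lambda>_. borel))" by measurable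
  have "integrable M (\<lambda>\<omega>. exp (- c * r * h) * (?\<phi> (\<lambda>i\<in>{..k}. incr h i \<omega>) * exp (c * complex_of_real (incr h (Suc k) \<omega>))))"
    by (intro integrable_mult_right past_times_incr(1)[OF h m i])
  also have "?this \<longleftrightarrow> ?case"
    by (intro Bochner_Integration.integrable_cong refl)
       (simp only: path_of_incr[OF _ order_refl] X_step, simp add: mult_exp_exp algebra_simps)
  finally show ?case .
qed

section \<open>Evolution of the stopped martingale on a fixed grid\<close>

definition alive :: "real \<Rightarrow> real \<Rightarrow> nat \<Rightarrow> 'a set" where
  "alive \<epsilon> h k = {\<omega> \<in> space M. \<forall>j\<le>k. \<epsilon> < X (real j * h) \<omega>}"

lemma alive_meas [measurable]: "alive \<epsilon> h k \<in> sets M"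
  unfolding alive_def by measurable

text \<open>\<open>alive \<epsilon> h k\<close> depends on the coordinates up to \<open>k\<close>
  only, so it is independent of the next increment. In the exponent, \<open>c\<^sup>2 / 2\<close>
  comes from the Gaussian increment and \<open>- r * c\<close> from the drift.\<close>

lemma alive_step:
  fixes c :: complex
  assumes h: "h > 0" and c: "Re c = r"
  shows "(CLINT \<omega>|M. indicator (alive \<epsilon> h k) \<omega> * exp (c * complex_of_real (X (real (Suc k) * h) \<omega>)))
    = exp (h * (c\<^sup>2 / 2 - r * c)) * (CLINT \<omega>|M. indicator (alive \<epsilon> h k) \<omega> * exp (c * complex_of_real (X (real k * h) \<omega>)))"
proof -
  let ?S = "{w \<in> space (PiM {..k} (\<lambda>_. borel)). \<forall>j\<le>k. \<epsilon> < path_of h w j}"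
  let ?\<phi> = "\<lambda>w. indicator ?S w * exp (c * complex_of_real (path_of h w k)) :: complex"
  let ?W = "\<lambda>\<omega>. \<lambda>i\<in>{..k}. incr h i \<omega>"
  have "{w \<in> space (PiM {..k} (\<lambda>_. borel)). \<forall>j\<in>{..k}. \<epsilon> < path_of h w j} \<in> sets (PiM {..k} (\<lambda>_. borel))"
    by (intro sets.sets_Collect_finite_All borel_measurable_less borel_measurable_const path_of_meas) auto
  then have "?S \<in> sets (PiM {..k} (\<lambda>_. borel))" by (simp add: Ball_def)
  then have m: "?\<phi> \<in> borel_measurable (PiM {..k} (\<lambda>_. borel))" by measurable
  have \<phi>: "?\<phi> (?W \<omega>) = indicator (alive \<epsilon> h k) \<omega> * exp (c * complex_of_real (X (real k * h) \<omega>))" if "\<omega> \<in> space M" for \<omega>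
    using that by (simp add: path_of_incr alive_def indicator_def space_PiM)
  have "integrable M (\<lambda>\<omega>. indicator (alive \<epsilon> h k) \<omega> * exp (c * complex_of_real (X (real k * h) \<omega>)))"
    by (rule Bochner_Integration.integrable_bound[OF X_cexp_integrable[OF h c, of k]]) (auto simp: indicator_def)
  then have i: "integrable M (\<lambda>\<omega>. ?\<phi> (?W \<omega>))"
    by (simp only: \<phi> cong: Bochner_Integration.integrable_cong)
  have "(CLINT \<omega>|M. indicator (alive \<epsilon> h k) \<omega> * exp (c * complex_of_real (X (real (Suc k) * h) \<omega>)))
    = (CLINT \<omega>|M. exp (- c * r * h) * (?\<phi> (?W \<omega>) * exp (c * complex_of_real (incr h (Suc k) \<omega>))))"
    by (intro Bochner_Integration.integral_cong refl)
       (simp only: \<phi> X_step, simp add: mult_exp_exp algebra_simps)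
  also have "\<dots> = exp (- c * r * h) * ((CLINT \<omega>|M. ?\<phi> (?W \<omega>)) * exp (h * c\<^sup>2 / 2))"
    by (simp only: integral_mult_right_zero past_times_incr(2)[OF h m i])
  also have "(CLINT \<omega>|M. ?\<phi> (?W \<omega>)) = (CLINT \<omega>|M. indicator (alive \<epsilon> h k) \<omega> * exp (c * complex_of_real (X (real k * h) \<omega>)))"
    by (intro Bochner_Integration.integral_cong refl \<phi>)
  finally show ?thesis by (simp add: mult_exp_exp algebra_simps)
qed

text \<open>The Dirichlet eigenfunction at 0 of the generator f''/2 - r f' of the process; its
  eigenvalue is \<open>- rate \<theta>\<close>.\<close>

definition wave :: "real \<Rightarrow> real \<Rightarrow> real" where
  "wave \<theta> x = exp (r * x) * sin (\<theta> * x)"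

definition rate :: "real \<Rightarrow> real" where
  "rate \<theta> = (r\<^sup>2 + \<theta>\<^sup>2) / 2"

lemma wave_meas [measurable]: "wave \<theta> \<in> borel_measurable borel"
  unfolding wave_def by measurable

lemma Im_cexp_wave: "Im (exp (Complex r \<theta> * complex_of_real x)) = wave \<theta> x"
  by (simp add: wave_def Im_exp)

lemma X_exp_integrable:
  assumes "h > 0"
  shows "integrable M (\<lambda>\<omega>. exp (r * X (real k * h) \<omega>))"
  using X_cexp_integrable[OF assms, of "complex_of_real r" k, THEN integrable_norm] by simp

lemma wave_integrable:
  assumes h: "h > 0" and A: "A \<in> sets M"
  shows "integrable M (\<lambda>\<omega>. indicator A \<omega> * wave \<theta> (X (real k * h) \<omega>))"
proof (rule Bochner_Integration.integrable_bound[OF X_exp_integrable[OF h, of k]])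
  show "AE \<omega> in M. norm (indicator A \<omega> * wave \<theta> (X (real k * h) \<omega>)) \<le> norm (exp (r * X (real k * h) \<omega>))"
    using abs_sin_le_one by (auto simp: wave_def abs_mult indicator_def mult_left_le)
qed (use A in measurable)

lemma wave_step:
  assumes h: "h > 0"
  shows "(\<integral>\<omega>. indicator (alive \<epsilon> h k) \<omega> * wave \<theta> (X (real (Suc k) * h) \<omega>) \<partial>M)
    = exp (- rate \<theta> * h) * (\<integral>\<omega>. indicator (alive \<epsilon> h k) \<omega> * wave \<theta> (X (real k * h) \<omega>) \<partial>M)"
proof -
  let ?c = "Complex r \<theta>"
  have i: "integrable M (\<lambda>\<omega>. indicator (alive \<epsilon> h k) \<omega> * exp (?c * complex_of_real (X (real j * h) \<omega>)))" for j
    by (rule Bochner_Integration.integrable_bound[OF X_cexp_integrable[OF h, of ?c j]]) (auto simp: indicator_def)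
  have Im: "(\<integral>\<omega>. indicator (alive \<epsilon> h k) \<omega> * wave \<theta> (X (real j * h) \<omega>) \<partial>M)
     = Im (CLINT \<omega>|M. indicator (alive \<epsilon> h k) \<omega> * exp (?c * complex_of_real (X (real j * h) \<omega>)))" for j
    unfolding integral_Im[OF i, symmetric]
    by (intro Bochner_Integration.integral_cong refl) (simp add: indicator_def Im_cexp_wave)
  \<comment> \<open>The square and the drift both contribute the imaginary part
    \<open>r * \<theta>\<close>, with opposite signs.\<close>
  have "h * (?c\<^sup>2 / 2 - r * ?c) = complex_of_real (- rate \<theta> * h)"
    by (simp add: complex_eq_iff rate_def power2_eq_square field_simps)
  then have "exp (h * (?c\<^sup>2 / 2 - r * ?c)) = complex_of_real (exp (- rate \<theta> * h))"
    by (simp only: exp_of_real)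
  then show ?thesis
    unfolding Im by (subst alive_step[OF h]) (simp_all del: of_nat_Suc)
qed

text \<open>The first bound holds however far below the level the path lands, because the
  exponential weight decays to the left; a large jump therefore costs no more than a constant times
  its probability. The second bound makes a landing near the origin cost only order
  \<open>\<epsilon>\<close>.\<close>

lemma wave_bound_low:
  assumes "x \<le> \<epsilon>" "\<epsilon> > 0"
  shows "\<bar>wave \<theta> x\<bar> \<le> exp (r * \<epsilon>)" and "- \<epsilon> \<le> x \<Longrightarrow> \<bar>wave \<theta> x\<bar> \<le> exp (r * \<epsilon>) * (\<bar>\<theta>\<bar> * \<epsilon>)"
proof -
  have e: "exp (r * x) \<le> exp (r * \<epsilon>)" using assms r by simp
  have "\<bar>wave \<theta> x\<bar> = exp (r * x) * \<bar>sin (\<theta> * x)\<bar>" by (simp add: wave_def abs_mult)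
  also have "\<dots> \<le> exp (r * \<epsilon>) * 1" using e by (intro mult_mono) auto
  finally show "\<bar>wave \<theta> x\<bar> \<le> exp (r * \<epsilon>)" by simp
  assume "- \<epsilon> \<le> x"
  then have "\<bar>x\<bar> \<le> \<epsilon>" using assms by auto
  have "\<bar>sin (\<theta> * x)\<bar> \<le> \<bar>\<theta> * x\<bar>" by (rule abs_sin_x_le_abs_x)
  also have "\<dots> \<le> \<bar>\<theta>\<bar> * \<epsilon>" using \<open>\<bar>x\<bar> \<le> \<epsilon>\<close> by (simp add: abs_mult mult_left_mono)
  finally show "\<bar>wave \<theta> x\<bar> \<le> exp (r * \<epsilon>) * (\<bar>\<theta>\<bar> * \<epsilon>)"
    using e by (auto simp: wave_def abs_mult intro!: mult_mono)
qed

lemma alive_Suc: "alive \<epsilon> h (Suc k) \<subseteq> alive \<epsilon> h k"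
  by (auto simp: alive_def)

text \<open>The bad event concerns the whole grid of \<open>n\<close> steps rather than one step.
  Its intersections with the decreasing events \<open>alive\<close> then telescope, so its
  probability is paid once and not once per step.\<close>

definition jump :: "real \<Rightarrow> real \<Rightarrow> nat \<Rightarrow> 'a set" where
  "jump \<epsilon> h n = {\<omega> \<in> space M. \<exists>k<n. \<epsilon> \<le> \<bar>X (real k * h) \<omega> - X (real (Suc k) * h) \<omega>\<bar>}"

lemma jump_meas [measurable]: "jump \<epsilon> h n \<in> sets M"
  unfolding jump_def by measurable

text \<open>A path that leaves \<open>{\<epsilon><..}\<close> in one step lands in \<open>{-\<epsilon>..\<epsilon>}\<close>, where the martingale is small,
  unless that step is a large jump.\<close>

lemma wave_increment:
  assumes h: "h > 0" and e: "\<epsilon> > 0" and k: "k < n"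
  defines "J \<equiv> jump \<epsilon> h n"
  shows "\<bar>(\<integral>\<omega>. indicator (alive \<epsilon> h (Suc k)) \<omega> * wave \<theta> (X (real (Suc k) * h) \<omega>) \<partial>M)
    - exp (- rate \<theta> * h) * (\<integral>\<omega>. indicator (alive \<epsilon> h k) \<omega> * wave \<theta> (X (real k * h) \<omega>) \<partial>M)\<bar>
    \<le> exp (r * \<epsilon>) * (\<bar>\<theta>\<bar> * \<epsilon> * (prob (alive \<epsilon> h k) - prob (alive \<epsilon> h (Suc k)))
       + (prob (alive \<epsilon> h k \<inter> J) - prob (alive \<epsilon> h (Suc k) \<inter> J)))"
proof -
  let ?D = "alive \<epsilon> h k - alive \<epsilon> h (Suc k)" and ?Y = "\<lambda>\<omega>. X (real (Suc k) * h) \<omega>"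
  have [measurable]: "J \<in> sets M" unfolding J_def by measurable
  \<comment> \<open>By \<open>wave_step\<close>, the subtracted term of the claim is the mean of the
    new value over \<open>alive \<epsilon> h k\<close>. Only the paths killed in this very step,
    those in \<open>?D\<close>, remain.\<close>
  have f1: "(\<integral>\<omega>. indicator (alive \<epsilon> h (Suc k)) \<omega> * wave \<theta> (?Y \<omega>) \<partial>M)
    - (\<integral>\<omega>. indicator (alive \<epsilon> h k) \<omega> * wave \<theta> (?Y \<omega>) \<partial>M)
    = - (\<integral>\<omega>. indicator ?D \<omega> * wave \<theta> (?Y \<omega>) \<partial>M)"
    unfolding Bochner_Integration.integral_diff[OF wave_integrable[OF h alive_meas] wave_integrable[OF h alive_meas], symmetric]
      integral_minus[symmetric]
    by (intro Bochner_Integration.integral_cong refl) (use alive_Suc in \<open>auto simp: indicator_def\<close>)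
  have f2: "\<bar>\<integral>\<omega>. indicator ?D \<omega> * wave \<theta> (?Y \<omega>) \<partial>M\<bar> \<le> (\<integral>\<omega>. \<bar>indicator ?D \<omega> * wave \<theta> (?Y \<omega>)\<bar> \<partial>M)"
    by (rule integral_abs_bound)
  have f3: "(\<integral>\<omega>. \<bar>indicator ?D \<omega> * wave \<theta> (?Y \<omega>)\<bar> \<partial>M)
     \<le> (\<integral>\<omega>. exp (r * \<epsilon>) * (\<bar>\<theta>\<bar> * \<epsilon> * indicator ?D \<omega> + indicator (?D \<inter> J) \<omega>) \<partial>M)"
  proof (rule integral_mono)
    show "integrable M (\<lambda>\<omega>. \<bar>indicator ?D \<omega> * wave \<theta> (?Y \<omega>)\<bar>)"
      by (intro integrable_abs wave_integrable h) measurable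
    show "integrable M (\<lambda>\<omega>. exp (r * \<epsilon>) * (\<bar>\<theta>\<bar> * \<epsilon> * indicator ?D \<omega> + indicator (?D \<inter> J) \<omega>))"
      by (intro integrable_mult_right Bochner_Integration.integrable_add integrable_real_indicator)
         (auto simp: less_top[symmetric])
    fix \<omega> assume w: "\<omega> \<in> space M"
    show "\<bar>indicator ?D \<omega> * wave \<theta> (?Y \<omega>)\<bar> \<le> exp (r * \<epsilon>) * (\<bar>\<theta>\<bar> * \<epsilon> * indicator ?D \<omega> + indicator (?D \<inter> J) \<omega>)"
    proof (cases "\<omega> \<in> ?D")
      case True
      then have Xk: "\<epsilon> < X (real k * h) \<omega>" and Y: "?Y \<omega> \<le> \<epsilon>"
        unfolding alive_def by (auto simp: le_Suc_eq simp del: of_nat_Suc)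
      show ?thesis
      proof (cases "\<omega> \<in> J")
        case True
        have "0 \<le> exp (r * \<epsilon>) * (\<bar>\<theta>\<bar> * \<epsilon>)" using e by simp
        then show ?thesis using True \<open>\<omega> \<in> ?D\<close> wave_bound_low(1)[OF Y e, of \<theta>]
          by (simp add: abs_mult distrib_left del: of_nat_Suc)
      next
        case False
        then have "X (real k * h) \<omega> - ?Y \<omega> < \<epsilon>" using k w unfolding J_def jump_def by fastforce
        then have "- \<epsilon> \<le> ?Y \<omega>" using Xk e by linarith
        then show ?thesis using False \<open>\<omega> \<in> ?D\<close> wave_bound_low(2)[OF Y e, of \<theta>]
          by (simp add: abs_mult del: of_nat_Suc)
      qed
    qed simp
  qed
  have pD: "prob ?D = prob (alive \<epsilon> h k) - prob (alive \<epsilon> h (Suc k))"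
    by (rule finite_measure_Diff[OF _ _ alive_Suc]) auto
  have pDJ: "prob (?D \<inter> J) = prob (alive \<epsilon> h k \<inter> J) - prob (alive \<epsilon> h (Suc k) \<inter> J)"
    using alive_Suc[of \<epsilon> h k]
    by (subst finite_measure_Diff[symmetric]) (auto intro!: arg_cong[where f=prob])
  have f4: "(\<integral>\<omega>. exp (r * \<epsilon>) * (\<bar>\<theta>\<bar> * \<epsilon> * indicator ?D \<omega> + indicator (?D \<inter> J) \<omega>) \<partial>M)
     = exp (r * \<epsilon>) * (\<bar>\<theta>\<bar> * \<epsilon> * prob ?D + prob (?D \<inter> J))"
    by (simp add: less_top[symmetric])
  show ?thesis
    unfolding wave_step[OF h, symmetric] f1 abs_minus_cancel
    using order_trans[OF f2 f3] unfolding f4 pD pDJ .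
qed

text \<open>Summation of \<open>wave_increment\<close> after multiplying by the growing factor of
  the martingale. All these factors up to \<open>n\<close> are bounded by the last one, and the
  probability differences telescope because \<open>n\<close> stays fixed in \<open>jump\<close>
  while \<open>m\<close> varies.\<close>

lemma wave_alive_bound:
  assumes h: "h > 0" and e: "\<epsilon> > 0"
  shows "m \<le> n \<Longrightarrow> \<bar>exp (rate \<theta> * (real m * h)) * (\<integral>\<omega>. indicator (alive \<epsilon> h m) \<omega> * wave \<theta> (X (real m * h) \<omega>) \<partial>M)
    - (\<integral>\<omega>. indicator (alive \<epsilon> h 0) \<omega> * wave \<theta> (X 0 \<omega>) \<partial>M)\<bar>
    \<le> exp (rate \<theta> * (real n * h)) * exp (r * \<epsilon>) * (\<bar>\<theta>\<bar> * \<epsilon> * (prob (alive \<epsilon> h 0) - prob (alive \<epsilon> h m))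
       + (prob (alive \<epsilon> h 0 \<inter> jump \<epsilon> h n) - prob (alive \<epsilon> h m \<inter> jump \<epsilon> h n)))"
proof (induction m)
  case 0
  then show ?case by simp
next
  case (Suc m)
  define F where "F k = (\<integral>\<omega>. indicator (alive \<epsilon> h k) \<omega> * wave \<theta> (X (real k * h) \<omega>) \<partial>M)" for k
  define G where "G k = \<bar>\<theta>\<bar> * \<epsilon> * (prob (alive \<epsilon> h k) - prob (alive \<epsilon> h (Suc k)))
       + (prob (alive \<epsilon> h k \<inter> jump \<epsilon> h n) - prob (alive \<epsilon> h (Suc k) \<inter> jump \<epsilon> h n))" for k
  have rate: "rate \<theta> \<ge> 0" by (simp add: rate_def)
  have G: "0 \<le> G m" unfolding G_def using e alive_Suc[of \<epsilon> h m]
    by (intro add_nonneg_nonneg mult_nonneg_nonneg) (auto intro!: finite_measure_mono)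
  have Fs: "\<bar>F (Suc m) - exp (- rate \<theta> * h) * F m\<bar> \<le> exp (r * \<epsilon>) * G m"
    unfolding F_def G_def using Suc.prems by (intro wave_increment h e) auto
  have "exp (rate \<theta> * (real (Suc m) * h)) * F (Suc m) - exp (rate \<theta> * (real m * h)) * F m
    = exp (rate \<theta> * (real (Suc m) * h)) * (F (Suc m) - exp (- rate \<theta> * h) * F m)"
    by (simp add: algebra_simps mult_exp_exp)
  then have "\<bar>exp (rate \<theta> * (real (Suc m) * h)) * F (Suc m) - exp (rate \<theta> * (real m * h)) * F m\<bar>
    = exp (rate \<theta> * (real (Suc m) * h)) * \<bar>F (Suc m) - exp (- rate \<theta> * h) * F m\<bar>"
    by (simp only: abs_mult abs_exp_cancel)
  also have "\<dots> \<le> exp (rate \<theta> * (real n * h)) * (exp (r * \<epsilon>) * G m)"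
    using Suc.prems rate h G Fs
    by (intro mult_mono) (auto intro!: mult_left_mono mult_right_mono simp del: of_nat_Suc)
  finally have "\<bar>exp (rate \<theta> * (real (Suc m) * h)) * F (Suc m) - exp (rate \<theta> * (real m * h)) * F m\<bar> \<le> exp (rate \<theta> * (real n * h)) * exp (r * \<epsilon>) * G m"
    by (simp add: mult.assoc)
  moreover note Suc.IH
  ultimately show ?case using Suc.prems unfolding F_def[symmetric] G_def
    by (simp add: algebra_simps del: of_nat_Suc)
qed

section \<open>Mesh to zero at a fixed level\<close>

definition step :: "real \<Rightarrow> nat \<Rightarrow> real" where
  "step t m = t / 2 ^ m"

definition above :: "real \<Rightarrow> real \<Rightarrow> 'a set" where
  "above \<epsilon> t = (\<Inter>m. alive \<epsilon> (step t m) (2 ^ m))"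

lemma above_meas [measurable]: "above \<epsilon> t \<in> sets M"
  unfolding above_def by measurable

lemma step_pos: "t > 0 \<Longrightarrow> step t m > 0"
  by (simp add: step_def)

lemma prob_jump_tendsto:
  assumes t: "t > 0" and e: "\<epsilon> > 0"
  shows "(\<lambda>m. prob (jump \<epsilon> (step t m) (2 ^ m))) \<longlonglongrightarrow> 0"
proof -
  have "(\<lambda>m. \<integral>\<omega>. indicator (jump \<epsilon> (step t m) (2 ^ m)) \<omega> \<partial>M) \<longlonglongrightarrow> (\<integral>\<omega>. 0 \<partial>M :: real)"
  proof (rule integral_dominated_convergence[where w="\<lambda>_. 1"])
    show "AE \<omega> in M. (\<lambda>m. indicator (jump \<epsilon> (step t m) (2 ^ m)) \<omega> :: real) \<longlonglongrightarrow> 0"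
    proof (rule AE_I2)
      fix \<omega> assume "\<omega> \<in> space M"
      from grid_osc_eventually[OF t X_cont_interval[OF this] e]
      have "\<forall>\<^sub>F m in sequentially. indicator (jump \<epsilon> (step t m) (2 ^ m)) \<omega> = (0 :: real)"
        by (rule eventually_mono) (auto simp: jump_def step_def indicator_def not_le simp del: of_nat_Suc)
      then show "(\<lambda>m. indicator (jump \<epsilon> (step t m) (2 ^ m)) \<omega> :: real) \<longlonglongrightarrow> 0"
        by (rule tendsto_eventually)
    qed
  qed auto
  then show ?thesis by simp
qed

text \<open>Point \<open>j\<close> of one dyadic grid is point \<open>2 * j\<close> of the next, so
  refinement only adds constraints. This monotonicity gives the pointwise limit of the
  indicators.\<close>

lemma decseq_alive: "decseq (\<lambda>m. alive \<epsilon> (step t m) (2 ^ m))"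
proof (rule decseq_SucI, rule subsetI)
  fix m \<omega> assume a: "\<omega> \<in> alive \<epsilon> (step t (Suc m)) (2 ^ Suc m)"
  show "\<omega> \<in> alive \<epsilon> (step t m) (2 ^ m)"
    unfolding alive_def
  proof (intro CollectI conjI allI impI)
    fix j assume "j \<le> (2::nat) ^ m"
    then have "2 * j \<le> 2 ^ Suc m" by simp
    then have "\<epsilon> < X (real (2 * j) * step t (Suc m)) \<omega>" using a unfolding alive_def by blast
    then show "\<epsilon> < X (real j * step t m) \<omega>" by (simp add: step_def)
  qed (use a in \<open>simp add: alive_def\<close>)
qed

text \<open>As the mesh is refined the jump probability vanishes, and the only error left is that of
  landing within \<open>\<epsilon>\<close> of the origin.\<close>

lemma wave_above_bound:
  assumes t: "t > 0" and e: "\<epsilon> > 0"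
  shows "\<bar>exp (rate \<theta> * t) * (\<integral>\<omega>. indicator (above \<epsilon> t) \<omega> * wave \<theta> (X t \<omega>) \<partial>M)
    - (\<integral>\<omega>. indicator {\<omega>\<in>space M. \<epsilon> < X0 \<omega>} \<omega> * wave \<theta> (X0 \<omega>) \<partial>M)\<bar>
    \<le> exp (rate \<theta> * t) * exp (r * \<epsilon>) * (\<bar>\<theta>\<bar> * \<epsilon>)"
proof -
  let ?A = "\<lambda>m. alive \<epsilon> (step t m) (2 ^ m)" and ?J = "\<lambda>m. jump \<epsilon> (step t m) (2 ^ m)"
  let ?I0 = "\<integral>\<omega>. indicator {\<omega>\<in>space M. \<epsilon> < X0 \<omega>} \<omega> * wave \<theta> (X0 \<omega>) \<partial>M"
  have full: "real (2 ^ m) * step t m = t" for m by (simp add: step_def)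
  have I0: "(\<integral>\<omega>. indicator (alive \<epsilon> (step t m) 0) \<omega> * wave \<theta> (X 0 \<omega>) \<partial>M) = ?I0" for m
    by (intro Bochner_Integration.integral_cong refl) (auto simp: alive_def X_0 indicator_def)
  have b: "\<bar>exp (rate \<theta> * t) * (\<integral>\<omega>. indicator (?A m) \<omega> * wave \<theta> (X t \<omega>) \<partial>M) - ?I0\<bar>
    \<le> exp (rate \<theta> * t) * exp (r * \<epsilon>) * (\<bar>\<theta>\<bar> * \<epsilon> + prob (?J m))" for m
  proof -
    have "\<bar>exp (rate \<theta> * t) * (\<integral>\<omega>. indicator (?A m) \<omega> * wave \<theta> (X t \<omega>) \<partial>M) - ?I0\<bar>
     \<le> exp (rate \<theta> * t) * exp (r * \<epsilon>) * (\<bar>\<theta>\<bar> * \<epsilon> * (prob (alive \<epsilon> (step t m) 0) - prob (?A m))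
       + (prob (alive \<epsilon> (step t m) 0 \<inter> ?J m) - prob (?A m \<inter> ?J m)))"
      using wave_alive_bound[OF step_pos[OF t, of m] e order_refl, where m="2^m" and \<theta>=\<theta>] unfolding full I0 .
    \<comment> \<open>After telescoping, the first difference is at most 1 and the second at most
      the probability of the bad event, uniformly in the number of steps.\<close>
    also have "\<dots> \<le> exp (rate \<theta> * t) * exp (r * \<epsilon>) * (\<bar>\<theta>\<bar> * \<epsilon> * 1 + prob (?J m))"
    proof (intro mult_left_mono add_mono)
      have "prob (alive \<epsilon> (step t m) 0) \<le> 1" "0 \<le> prob (?A m)" by simp_all
      then show "prob (alive \<epsilon> (step t m) 0) - prob (?A m) \<le> 1" by linarith
      have "prob (alive \<epsilon> (step t m) 0 \<inter> ?J m) \<le> prob (?J m)" "0 \<le> prob (?A m \<inter> ?J m)"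
        by (auto intro!: finite_measure_mono)
      then show "prob (alive \<epsilon> (step t m) 0 \<inter> ?J m) - prob (?A m \<inter> ?J m) \<le> prob (?J m)" by linarith
    qed (use e in auto)
    finally show ?thesis by simp
  qed
  have X1: "integrable M (\<lambda>\<omega>. exp (r * X t \<omega>))" using X_exp_integrable[OF t, of 1] by simp
  have L: "(\<lambda>m. \<integral>\<omega>. indicator (?A m) \<omega> * wave \<theta> (X t \<omega>) \<partial>M) \<longlonglongrightarrow> (\<integral>\<omega>. indicator (above \<epsilon> t) \<omega> * wave \<theta> (X t \<omega>) \<partial>M)"
  proof (rule integral_dominated_convergence[where w="\<lambda>\<omega>. exp (r * X t \<omega>)"])
    show "AE \<omega> in M. (\<lambda>m. indicator (?A m) \<omega> * wave \<theta> (X t \<omega>)) \<longlonglongrightarrow> indicator (above \<epsilon> t) \<omega> * wave \<theta> (X t \<omega>)"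
      unfolding above_def by (intro AE_I2 tendsto_intros LIMSEQ_indicator_decseq decseq_alive)
    show "AE \<omega> in M. norm (indicator (?A m) \<omega> * wave \<theta> (X t \<omega>)) \<le> exp (r * X t \<omega>)" for m
      using abs_sin_le_one by (auto simp: wave_def abs_mult indicator_def mult_left_le)
  qed (use X1 in auto)
  have "(\<lambda>m. exp (rate \<theta> * t) * exp (r * \<epsilon>) * (\<bar>\<theta>\<bar> * \<epsilon> + prob (?J m)))
    \<longlonglongrightarrow> exp (rate \<theta> * t) * exp (r * \<epsilon>) * (\<bar>\<theta>\<bar> * \<epsilon> + 0)"
    by (intro tendsto_intros prob_jump_tendsto t e)
  moreover have "(\<lambda>m. \<bar>exp (rate \<theta> * t) * (\<integral>\<omega>. indicator (?A m) \<omega> * wave \<theta> (X t \<omega>) \<partial>M) - ?I0\<bar>)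
    \<longlonglongrightarrow> \<bar>exp (rate \<theta> * t) * (\<integral>\<omega>. indicator (above \<epsilon> t) \<omega> * wave \<theta> (X t \<omega>) \<partial>M) - ?I0\<bar>"
    by (intro tendsto_intros L)
  ultimately show ?thesis
    using b by (intro LIMSEQ_le[of _ _ "\<lambda>m. exp (rate \<theta> * t) * exp (r * \<epsilon>) * (\<bar>\<theta>\<bar> * \<epsilon> + prob (?J m))"]) auto
qed

section \<open>Level to zero: the survival event\<close>

definition survive :: "real \<Rightarrow> 'a set" where
  "survive t = {\<omega> \<in> space M. ereal t < hit0 X \<omega>}"

lemma survive_iff:
  assumes "0 \<le> t" "\<omega> \<in> space M"
  shows "\<omega> \<in> survive t \<longleftrightarrow> (\<forall>s\<in>{0..t}. X s \<omega> \<noteq> 0)"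
  unfolding survive_def using assms hit0_gt_iff[of t X \<omega>, OF assms(1) X_cont[OF assms(2)]] by simp

text \<open>A zero-free continuous path on a compact interval is bounded away from zero by some
  \<open>1 / real (Suc n)\<close>, and such a bound can be tested on dyadic points. The absolute
  value is there because \<open>X0\<close> is positive only almost everywhere.\<close>

lemma survive_meas [measurable]:
  assumes t: "t > 0"
  shows "survive t \<in> sets M"
proof -
  have "survive t = {\<omega> \<in> space M. \<exists>n. \<forall>m. \<forall>k. k \<le> (2::nat) ^ m \<longrightarrow> 1 / real (Suc n) \<le> \<bar>X (real k * (t / 2 ^ m)) \<omega>\<bar>}"
    (is "_ = ?R")
  proof (intro set_eqI iffI)
    fix \<omega> assume w: "\<omega> \<in> survive t"
    then have sp: "\<omega> \<in> space M" by (simp add: survive_def)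
    obtain a where a: "a > 0" "\<And>s. s \<in> {0..t} \<Longrightarrow> a \<le> \<bar>X s \<omega>\<bar>"
      using survive_iff[OF less_imp_le[OF t] sp] w t
        interval_pos_lower[of t "\<lambda>s. \<bar>X s \<omega>\<bar>", OF _ continuous_on_rabs[OF X_cont_interval[OF sp]]] by auto
    obtain n where "1 / real (Suc n) < a" using a(1) by (meson nat_approx_posE)
    then show "\<omega> \<in> ?R" using sp a(2) grid_mem[OF t]
      by (intro CollectI conjI exI[of _ n]) (auto intro: order_trans[OF less_imp_le])
  next
    fix \<omega> assume "\<omega> \<in> ?R"
    then obtain n where sp: "\<omega> \<in> space M" and
      n: "\<And>m k. k \<le> (2::nat) ^ m \<Longrightarrow> 1 / real (Suc n) \<le> \<bar>X (real k * (t / 2 ^ m)) \<omega>\<bar>" by blast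
    have "1 / real (Suc n) \<le> \<bar>X s \<omega>\<bar>" if "s \<in> {0..t}" for s
      by (rule grid_dense[OF t continuous_on_rabs[OF X_cont_interval[OF sp]] n that])
    moreover have "0 < 1 / real (Suc n)" by simp
    ultimately show "\<omega> \<in> survive t"
      unfolding survive_iff[OF less_imp_le[OF t] sp] by fastforce
  qed
  then show ?thesis by simp
qed

lemma survive_pos:
  assumes t: "0 \<le> t" and w: "\<omega> \<in> space M" "0 < X0 \<omega>" and s: "\<omega> \<in> survive t" and u: "u \<in> {0..t}"
  shows "0 < X u \<omega>"
proof (rule ccontr)
  assume "\<not> 0 < X u \<omega>"
  then have "\<exists>x. 0 \<le> x \<and> x \<le> u \<and> X x \<omega> = 0"
    using w u by (intro IVT2' continuous_on_subset[OF X_cont[OF w(1)]]) (auto simp: X_0)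
  then show False using s u unfolding survive_iff[OF t w(1)] by auto
qed

text \<open>A surviving path has a positive minimum, so it lies in \<open>above\<close> for all
  small levels. A path that does not survive lies in none, since the grid bound extends to all of
  \<open>{0..t}\<close> and would keep it away from zero.\<close>

lemma above_tendsto_survive:
  assumes t: "t > 0" and w: "\<omega> \<in> space M" "0 < X0 \<omega>"
  shows "(\<lambda>n. indicator (above (1 / real (Suc n)) t) \<omega> :: real) \<longlonglongrightarrow> indicator (survive t) \<omega>"
proof (cases "\<omega> \<in> survive t")
  case True
  obtain a where a: "a > 0" "\<And>s. s \<in> {0..t} \<Longrightarrow> a \<le> X s \<omega>"
    using interval_pos_lower[OF less_imp_le[OF t] X_cont_interval[OF w(1)] survive_pos[OF less_imp_le[OF t] w True]] by blast
  have "\<forall>\<^sub>F n in sequentially. 1 / real (Suc n) < a"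
    using LIMSEQ_inverse_real_of_nat a(1) unfolding inverse_eq_divide by (intro order_tendstoD(2)[of _ 0]) auto
  then have "\<forall>\<^sub>F n in sequentially. indicator (above (1 / real (Suc n)) t) \<omega> = (1::real)"
  proof (rule eventually_mono)
    fix n assume n: "1 / real (Suc n) < a"
    have "1 / real (Suc n) < X (real j * step t m) \<omega>" if "j \<le> 2 ^ m" for j m
      using a(2)[OF grid_mem[OF t that]] n by (simp add: step_def)
    then show "indicator (above (1 / real (Suc n)) t) \<omega> = (1::real)"
      using w by (auto simp: above_def alive_def indicator_def)
  qed
  then show ?thesis using True by (simp add: tendsto_eventually)
next
  case False
  have "\<omega> \<notin> above (1 / real (Suc n)) t" for n
  proof
    assume ab: "\<omega> \<in> above (1 / real (Suc n)) t"
    have "1 / real (Suc n) \<le> X (real k * (t / 2 ^ m)) \<omega>" if "k \<le> 2 ^ m" for m k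
    proof -
      have "\<omega> \<in> alive (1 / real (Suc n)) (step t m) (2 ^ m)" using ab by (auto simp: above_def)
      then show ?thesis using that unfolding alive_def step_def by (auto intro: less_imp_le simp del: of_nat_Suc)
    qed
    from grid_dense[OF t X_cont_interval[OF w(1)] this]
    have "1 / real (Suc n) \<le> X s \<omega>" if "s \<in> {0..t}" for s using that by blast
    moreover have "0 < 1 / real (Suc n)" by simp
    ultimately show False
      using False unfolding survive_iff[OF less_imp_le[OF t] w(1)] by fastforce
  qed
  then show ?thesis using False by simp
qed

text \<open>The error in \<open>wave_above_bound\<close> is linear in the level up to bounded
  factors, hence the inequality becomes an identity in the limit; the condition on the initial value
  disappears because \<open>X0\<close> is positive almost everywhere.\<close>

theorem survive_wave:
  assumes t: "t > 0"
  shows "(\<integral>\<omega>. indicator (survive t) \<omega> * wave \<theta> (X t \<omega>) \<partial>M) = exp (- rate \<theta> * t) * (\<integral>\<omega>. wave \<theta> (X0 \<omega>) \<partial>M)"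
proof -
  have [measurable]: "survive t \<in> sets M" using t by (rule survive_meas)
  let ?e = "\<lambda>n. 1 / real (Suc n)"
  have e0: "?e \<longlonglongrightarrow> 0" using LIMSEQ_inverse_real_of_nat unfolding inverse_eq_divide .
  have X1: "integrable M (\<lambda>\<omega>. exp (r * X t \<omega>))" using X_exp_integrable[OF t, of 1] by simp
  have L1: "(\<lambda>n. \<integral>\<omega>. indicator (above (?e n) t) \<omega> * wave \<theta> (X t \<omega>) \<partial>M) \<longlonglongrightarrow> (\<integral>\<omega>. indicator (survive t) \<omega> * wave \<theta> (X t \<omega>) \<partial>M)"
  proof (rule integral_dominated_convergence[where w="\<lambda>\<omega>. exp (r * X t \<omega>)"])
    show "AE \<omega> in M. (\<lambda>n. indicator (above (?e n) t) \<omega> * wave \<theta> (X t \<omega>)) \<longlonglongrightarrow> indicator (survive t) \<omega> * wave \<theta> (X t \<omega>)"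
      using X0_pos AE_space
    proof eventually_elim
      case (elim \<omega>)
      then show ?case by (intro tendsto_intros above_tendsto_survive t)
    qed
    show "AE \<omega> in M. norm (indicator (above (?e m) t) \<omega> * wave \<theta> (X t \<omega>)) \<le> exp (r * X t \<omega>)" for m
      using abs_sin_le_one by (auto simp: wave_def abs_mult indicator_def mult_left_le)
  qed (use X1 in auto)
  have L2: "(\<lambda>n. \<integral>\<omega>. indicator {\<omega>\<in>space M. ?e n < X0 \<omega>} \<omega> * wave \<theta> (X0 \<omega>) \<partial>M) \<longlonglongrightarrow> (\<integral>\<omega>. wave \<theta> (X0 \<omega>) \<partial>M)"
  proof (rule integral_dominated_convergence[where w="\<lambda>\<omega>. exp (r * X0 \<omega>)"])
    show "AE \<omega> in M. (\<lambda>n. indicator {\<omega>\<in>space M. ?e n < X0 \<omega>} \<omega> * wave \<theta> (X0 \<omega>)) \<longlonglongrightarrow> wave \<theta> (X0 \<omega>)"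
      using X0_pos AE_space
    proof eventually_elim
      case (elim \<omega>)
      have "\<forall>\<^sub>F n in sequentially. ?e n < X0 \<omega>" using e0 elim(1) by (intro order_tendstoD(2)[of _ 0]) auto
      then have "\<forall>\<^sub>F n in sequentially. indicator {\<omega>\<in>space M. ?e n < X0 \<omega>} \<omega> * wave \<theta> (X0 \<omega>) = wave \<theta> (X0 \<omega>)"
        by (rule eventually_mono) (use elim in simp)
      then show ?case by (rule tendsto_eventually)
    qed
    show "AE \<omega> in M. norm (indicator {\<omega>\<in>space M. ?e m < X0 \<omega>} \<omega> * wave \<theta> (X0 \<omega>)) \<le> exp (r * X0 \<omega>)" for m
      using abs_sin_le_one by (auto simp: wave_def abs_mult indicator_def mult_left_le)
  qed (use X0_exp in auto)
  have "(\<lambda>n. exp (rate \<theta> * t) * exp (r * ?e n) * (\<bar>\<theta>\<bar> * ?e n)) \<longlonglongrightarrow> exp (rate \<theta> * t) * exp (r * 0) * (\<bar>\<theta>\<bar> * 0)"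
    by (intro tendsto_intros e0)
  moreover have "(\<lambda>n. \<bar>exp (rate \<theta> * t) * (\<integral>\<omega>. indicator (above (?e n) t) \<omega> * wave \<theta> (X t \<omega>) \<partial>M)
      - (\<integral>\<omega>. indicator {\<omega>\<in>space M. ?e n < X0 \<omega>} \<omega> * wave \<theta> (X0 \<omega>) \<partial>M)\<bar>)
     \<longlonglongrightarrow> \<bar>exp (rate \<theta> * t) * (\<integral>\<omega>. indicator (survive t) \<omega> * wave \<theta> (X t \<omega>) \<partial>M) - (\<integral>\<omega>. wave \<theta> (X0 \<omega>) \<partial>M)\<bar>"
    by (intro tendsto_intros L1 L2)
  moreover have "\<bar>exp (rate \<theta> * t) * (\<integral>\<omega>. indicator (above (?e n) t) \<omega> * wave \<theta> (X t \<omega>) \<partial>M)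
      - (\<integral>\<omega>. indicator {\<omega>\<in>space M. ?e n < X0 \<omega>} \<omega> * wave \<theta> (X0 \<omega>) \<partial>M)\<bar>
      \<le> exp (rate \<theta> * t) * exp (r * ?e n) * (\<bar>\<theta>\<bar> * ?e n)" for n
    by (rule wave_above_bound[OF t]) simp
  ultimately have "\<bar>exp (rate \<theta> * t) * (\<integral>\<omega>. indicator (survive t) \<omega> * wave \<theta> (X t \<omega>) \<partial>M) - (\<integral>\<omega>. wave \<theta> (X0 \<omega>) \<partial>M)\<bar>
     \<le> exp (rate \<theta> * t) * exp (r * 0) * (\<bar>\<theta>\<bar> * 0)"
    by (intro LIMSEQ_le) auto
  then have "exp (rate \<theta> * t) * (\<integral>\<omega>. indicator (survive t) \<omega> * wave \<theta> (X t \<omega>) \<partial>M) = (\<integral>\<omega>. wave \<theta> (X0 \<omega>) \<partial>M)"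
    by simp
  then show ?thesis by (simp add: exp_minus field_simps)
qed

end

section \<open>The law of the killed process\<close>

lemma normal_density_sin_integral:
  assumes "\<sigma> > 0"
  shows "(\<integral>y. normal_density m \<sigma> y * sin (\<theta> * y) \<partial>lborel) = sin (\<theta> * m) * exp (- (\<theta> * \<sigma>)\<^sup>2 / 2)"
    and "integrable lborel (\<lambda>y. normal_density m \<sigma> y * sin (\<theta> * y))"
proof -
  have i: "integrable lborel (\<lambda>y. normal_density m \<sigma> y *\<^sub>R iexp (\<theta> * y))"
    using integrable_normal_density_cexp[OF assms, of m "\<i> * \<theta>"] by (simp add: mult.assoc)
  have Im: "Im (normal_density m \<sigma> y *\<^sub>R iexp (\<theta> * y)) = normal_density m \<sigma> y * sin (\<theta> * y)" for y
    by (simp add: Im_exp)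
  show "integrable lborel (\<lambda>y. normal_density m \<sigma> y * sin (\<theta> * y))"
    using integrable_Im[OF i] unfolding Im .
  have "(\<integral>y. normal_density m \<sigma> y * sin (\<theta> * y) \<partial>lborel) = Im (iexp (\<theta> * m) * exp (- (\<theta> * \<sigma>)\<^sup>2 / 2))"
    using integral_Im[OF i] unfolding Im normal_density_iexp_integral[OF assms] .
  then show "(\<integral>y. normal_density m \<sigma> y * sin (\<theta> * y) \<partial>lborel) = sin (\<theta> * m) * exp (- (\<theta> * \<sigma>)\<^sup>2 / 2)"
    by (simp add: Im_exp)
qed

lemma integral_even_half:
  fixes f :: "real \<Rightarrow> real"
  assumes f: "integrable lborel f" and even: "\<And>y. f (- y) = f y" and 0: "f 0 = 0"
  shows "(\<integral>y. indicator {0<..} y * f y \<partial>lborel) = (\<integral>y. f y \<partial>lborel) / 2"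
proof -
  have i: "integrable lborel (\<lambda>y. indicator {0<..} y * f y)" "integrable lborel (\<lambda>y. indicator {..<0} y * f y)"
    using integrable_real_mult_indicator[OF _ f] by (simp_all add: mult.commute)
  have "(\<integral>y. f y \<partial>lborel) = (\<integral>y. indicator {0<..} y * f y + indicator {..<0} y * f y \<partial>lborel)"
    by (intro Bochner_Integration.integral_cong refl) (auto simp: indicator_def 0 not_less dest: antisym)
  also have "\<dots> = (\<integral>y. indicator {0<..} y * f y \<partial>lborel) + (\<integral>y. indicator {..<0} y * f y \<partial>lborel)"
    by (rule Bochner_Integration.integral_add[OF i])
  also have "(\<integral>y. indicator {..<0} y * f y \<partial>lborel) = (\<integral>y. indicator {0<..} y * f y \<partial>lborel)"
    by (subst lborel_integral_real_affine[of "-1" _ 0])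
       (auto simp: even indicator_def intro!: Bochner_Integration.integral_cong)
  finally show ?thesis by simp
qed

text \<open>For \<open>x * y = 0\<close> division by zero makes the last factor 0 instead of its
  limit 1, so the estimates below are stated for positive arguments.\<close>

definition kernel :: "real \<Rightarrow> real \<Rightarrow> real \<Rightarrow> real" where
  "kernel t x y = exp (- (x\<^sup>2 + y\<^sup>2) / (2 * t)) * (sinh (x * y / t) / (x * y / t))"

text \<open>The factor \<open>x * y\<close> is extracted so that the remaining kernel tends to 1 for
  large \<open>t\<close>. Later \<open>x\<close> joins the weight of the initial value and
  \<open>y\<close> becomes the linear factor of the Yaglom density.\<close>

lemma normal_density_reflect_diff:
  assumes "t > 0" "x > 0" "y > 0"
  shows "normal_density x (sqrt t) y - normal_density (- x) (sqrt t) y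
    = 2 / (t * sqrt (2 * pi * t)) * (x * y * kernel t x y)"
proof -
  have e: "- (y - x)\<^sup>2 / (2 * t) = - (x\<^sup>2 + y\<^sup>2) / (2 * t) + x * y / t"
    "- (y + x)\<^sup>2 / (2 * t) = - (x\<^sup>2 + y\<^sup>2) / (2 * t) + - (x * y / t)"
    using assms by (simp_all add: power2_eq_square field_simps)
  have "normal_density x (sqrt t) y - normal_density (- x) (sqrt t) y
    = 1 / sqrt (2 * pi * t) * (exp (- (y - x)\<^sup>2 / (2 * t)) - exp (- (y + x)\<^sup>2 / (2 * t)))"
    using assms by (simp add: normal_density_def right_diff_distrib)
  also have "\<dots> = 1 / sqrt (2 * pi * t) * (exp (- (x\<^sup>2 + y\<^sup>2) / (2 * t)) * (2 * sinh (x * y / t)))"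
    unfolding e exp_add by (simp add: sinh_field_def algebra_simps)
  also have "2 * sinh (x * y / t) = 2 / t * (x * y * (sinh (x * y / t) / (x * y / t)))"
    using assms by simp
  finally show ?thesis by (simp add: kernel_def)
qed

text \<open>All three follow from \<open>sinh z / z\<close> lying between 1 and
  \<open>exp z\<close>. The upper bound on it completes the square to a Gaussian in
  \<open>x - y\<close>; the lower bound leaves the first exponential, to which 1 + u <= exp u
  applies.\<close>

lemma kernel_bounds:
  assumes "t > 0" "x > 0" "y > 0"
  shows "0 \<le> kernel t x y" and "kernel t x y \<le> 1" and "1 - kernel t x y \<le> (x\<^sup>2 + y\<^sup>2) / (2 * t)"
proof -
  define z where "z = x * y / t"
  have z: "z > 0" using assms by (simp add: z_def)
  have "z \<le> sinh z"
    using real_le_x_sinh[of z] z by (simp add: sinh_field_def exp_minus)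
  then have S1: "1 \<le> sinh z / z" using z by simp
  have "1 + (- 2 * z) \<le> exp (- 2 * z)" by (rule exp_ge_add_one_self)
  then have "exp z * (1 + (- 2 * z)) \<le> exp z * exp (- 2 * z)" by (intro mult_left_mono) auto
  then have "sinh z \<le> z * exp z"
    by (simp add: sinh_field_def mult_exp_exp algebra_simps)
  then have S2: "sinh z / z \<le> exp z" using z by (simp add: pos_divide_le_eq mult.commute)
  have K: "kernel t x y = exp (- (x\<^sup>2 + y\<^sup>2) / (2 * t)) * (sinh z / z)" by (simp add: kernel_def z_def)
  show "0 \<le> kernel t x y" unfolding K using S1 by (intro mult_nonneg_nonneg) auto
  have "kernel t x y \<le> exp (- (x\<^sup>2 + y\<^sup>2) / (2 * t)) * exp z"
    unfolding K using S2 by (intro mult_left_mono) auto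
  also have "\<dots> = exp (- ((x - y)\<^sup>2 / (2 * t)))"
    unfolding z_def mult_exp_exp using assms by (intro arg_cong[where f=exp]) (simp add: field_simps power2_eq_square)
  also have "\<dots> \<le> 1" using assms by simp
  finally show "kernel t x y \<le> 1" .
  have "1 + (- (x\<^sup>2 + y\<^sup>2) / (2 * t)) \<le> exp (- (x\<^sup>2 + y\<^sup>2) / (2 * t))" by (rule exp_ge_add_one_self)
  also have "\<dots> * 1 \<le> kernel t x y"
    unfolding K using S1 by (intro mult_left_mono) auto
  finally show "1 - kernel t x y \<le> (x\<^sup>2 + y\<^sup>2) / (2 * t)" by (simp add: minus_divide_left[symmetric] del: minus_add_distrib)
qed

text \<open>The index of \<open>erlang_density\<close> is the shape minus one: this is the Gamma law
  of shape 2 and rate \<open>r\<close>.\<close>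

lemma yaglom_erlang: "yaglom r = density lborel (\<lambda>y. ennreal (erlang_density 1 r y))"
  unfolding yaglom_def
  by (intro arg_cong[where f="density lborel"] ext) (auto simp: erlang_density_def indicator_def power2_eq_square)

lemma sets_yaglom [measurable_cong, simp]: "sets (yaglom r) = sets borel"
  and space_yaglom [simp]: "space (yaglom r) = UNIV"
  by (simp_all add: yaglom_def)

lemma AE_yaglom: "AE y in yaglom r. 0 < y"
  unfolding yaglom_def by (subst AE_density) (auto simp: indicator_def)

lemma yaglom_moments:
  assumes r: "r > 0"
  shows "integrable (yaglom r) (\<lambda>y. y ^ k)" and "(\<integral>y. y ^ k \<partial>yaglom r) = fact (Suc k) / r ^ k"
proof -
  have "(\<integral>\<^sup>+y. ennreal (y ^ k) \<partial>yaglom r) = (\<integral>\<^sup>+y. ennreal (erlang_density 1 r y * y ^ k) \<partial>lborel)"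
    unfolding yaglom_erlang using r by (subst nn_integral_density) (auto simp: ennreal_mult' intro!: nn_integral_cong)
  also have "\<dots> = ennreal (fact (Suc k) / r ^ k)"
    using nn_integral_erlang_ith_moment[OF r, of 1 k] by simp
  finally have n: "(\<integral>\<^sup>+y. ennreal (y ^ k) \<partial>yaglom r) = ennreal (fact (Suc k) / r ^ k)" .
  have ae: "AE y in yaglom r. 0 \<le> y ^ k"
    using AE_yaglom by eventually_elim simp
  have "has_bochner_integral (yaglom r) (\<lambda>y. y ^ k) (fact (Suc k) / r ^ k)"
    by (rule has_bochner_integral_nn_integral[OF _ ae _ n]) (use r in auto)
  then show "integrable (yaglom r) (\<lambda>y. y ^ k)" "(\<integral>y. y ^ k \<partial>yaglom r) = fact (Suc k) / r ^ k"
    by (auto simp: has_bochner_integral_iff)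
qed

lemma prob_space_yaglom: "r > 0 \<Longrightarrow> prob_space (yaglom r)"
  unfolding yaglom_erlang by (rule prob_space_erlang_density)

section \<open>Identification of the killed law by the method of images\<close>

context drifted_bm begin

text \<open>A source at \<open>X0 \<omega>\<close> and a sink at its mirror image: the difference is
  odd in \<open>y\<close>, hence vanishes at 0. The drift is present only through the exponential
  weight.\<close>

definition image_density :: "real \<Rightarrow> real \<Rightarrow> 'a \<Rightarrow> real" where
  "image_density t y \<omega> = exp (r * X0 \<omega>) * (normal_density (X0 \<omega>) (sqrt t) y - normal_density (- X0 \<omega>) (sqrt t) y)"

text \<open>On \<open>y > 0\<close>, the density of the killed process weighted by
  \<open>exp (r * X t \<omega>)\<close>, not yet of the killed law itself.\<close>

definition dens :: "real \<Rightarrow> real \<Rightarrow> real" where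
  "dens t y = exp (- r\<^sup>2 * t / 2) * (\<integral>\<omega>. image_density t y \<omega> \<partial>M)"

lemma image_density_meas [measurable]: "(\<lambda>(\<omega>, y). image_density t y \<omega>) \<in> borel_measurable (M \<Otimes>\<^sub>M lborel)"
  unfolding image_density_def normal_density_def by measurable

lemma dens_meas [measurable]: "dens t \<in> borel_measurable borel"
  unfolding dens_def image_density_def normal_density_def by measurable

lemma dens_nonneg:
  assumes t: "t > 0" and y: "y > 0"
  shows "0 \<le> dens t y"
proof -
  have "AE \<omega> in M. 0 \<le> image_density t y \<omega>"
    using X0_pos
  proof eventually_elim
    case (elim \<omega>)
    then show ?case using t y kernel_bounds(1)[OF t elim y]
      by (simp add: image_density_def normal_density_reflect_diff)
  qed
  then show ?thesis unfolding dens_def by (intro mult_nonneg_nonneg integral_nonneg_AE) auto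
qed

lemma image_density_integrable:
  assumes t: "t > 0"
  shows "integrable (M \<Otimes>\<^sub>M lborel) (\<lambda>(\<omega>, y). image_density t y \<omega>)"
proof -
  interpret L: pair_sigma_finite M lborel ..
  have "integrable (M \<Otimes>\<^sub>M lborel) (\<lambda>(\<omega>, y). exp (r * X0 \<omega>) * normal_density (s * X0 \<omega>) (sqrt t) y)" for s
  proof (rule L.Fubini_integrable)
    show "(\<lambda>(\<omega>, y). exp (r * X0 \<omega>) * normal_density (s * X0 \<omega>) (sqrt t) y) \<in> borel_measurable (M \<Otimes>\<^sub>M lborel)"
      unfolding normal_density_def by measurable
    show "integrable M (\<lambda>\<omega>. \<integral>y. norm (case (\<omega>, y) of (\<omega>, y) \<Rightarrow> exp (r * X0 \<omega>) * normal_density (s * X0 \<omega>) (sqrt t) y) \<partial>lborel)"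
      using X0_exp t by (simp add: abs_mult)
    show "AE \<omega> in M. integrable lborel (\<lambda>y. case (\<omega>, y) of (\<omega>, y) \<Rightarrow> exp (r * X0 \<omega>) * normal_density (s * X0 \<omega>) (sqrt t) y)"
      using t by (auto intro!: AE_I2)
  qed
  from Bochner_Integration.integrable_diff[OF this[of 1] this[of "-1"]]
  show ?thesis by (simp add: image_density_def right_diff_distrib case_prod_beta')
qed

lemma dens_test:
  assumes t: "t > 0" and g: "g \<in> borel_measurable borel" and b: "\<And>y. \<bar>g y\<bar> \<le> 1"
  shows "integrable lborel (\<lambda>y. dens t y * g y)"
    and "(\<integral>y. dens t y * g y \<partial>lborel) = exp (- r\<^sup>2 * t / 2) * (\<integral>\<omega>. (\<integral>y. image_density t y \<omega> * g y \<partial>lborel) \<partial>M)"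
proof -
  interpret L: pair_sigma_finite M lborel ..
  note [measurable] = g
  have "integrable (M \<Otimes>\<^sub>M lborel) (\<lambda>(\<omega>, y). image_density t y \<omega> * g y)"
    by (rule Bochner_Integration.integrable_bound[OF image_density_integrable[OF t]])
       (auto simp: abs_mult b mult_left_le intro!: AE_I2)
  note i = this
  have eq: "dens t y * g y = exp (- r\<^sup>2 * t / 2) * (\<integral>\<omega>. image_density t y \<omega> * g y \<partial>M)" for y
    by (simp add: dens_def)
  show "integrable lborel (\<lambda>y. dens t y * g y)"
    unfolding eq by (intro integrable_mult_right L.integrable_snd i)
  show "(\<integral>y. dens t y * g y \<partial>lborel) = exp (- r\<^sup>2 * t / 2) * (\<integral>\<omega>. (\<integral>y. image_density t y \<omega> * g y \<partial>lborel) \<partial>M)"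
    unfolding eq integral_mult_right_zero using L.Fubini_integral[OF i] by simp
qed

text \<open>An odd density times a sine is even, so the half-line integral is half of the full one.
  The two Gaussians have opposite sine transforms and are subtracted, which cancels the factor one
  half.\<close>

lemma image_density_sin:
  assumes t: "t > 0"
  shows "(\<integral>y. image_density t y \<omega> * (indicator {0<..} y * sin (\<theta> * y)) \<partial>lborel) = wave \<theta> (X0 \<omega>) * exp (- \<theta>\<^sup>2 * t / 2)"
proof -
  let ?f = "\<lambda>y. normal_density (X0 \<omega>) (sqrt t) y * sin (\<theta> * y) - normal_density (- X0 \<omega>) (sqrt t) y * sin (\<theta> * y)"
  have s: "sqrt t > 0" using t by simp
  note i = normal_density_sin_integral(2)[OF s]
  have "(\<integral>y. image_density t y \<omega> * (indicator {0<..} y * sin (\<theta> * y)) \<partial>lborel)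
    = (\<integral>y. exp (r * X0 \<omega>) * (indicator {0<..} y * ?f y) \<partial>lborel)"
    by (intro Bochner_Integration.integral_cong refl) (simp add: image_density_def algebra_simps)
  also have "\<dots> = exp (r * X0 \<omega>) * ((\<integral>y. ?f y \<partial>lborel) / 2)"
    unfolding integral_mult_right_zero
  proof (subst integral_even_half)
    show "?f (- y) = ?f y" for y
    proof -
      have "(- y - X0 \<omega>)\<^sup>2 = (y + X0 \<omega>)\<^sup>2" "(- y + X0 \<omega>)\<^sup>2 = (y - X0 \<omega>)\<^sup>2"
        by (simp_all add: power2_eq_square algebra_simps)
      then show ?thesis by (simp add: normal_density_def)
    qed
  qed (auto intro!: Bochner_Integration.integrable_diff i)
  also have "(\<integral>y. ?f y \<partial>lborel) = 2 * (sin (\<theta> * X0 \<omega>) * exp (- (\<theta> * sqrt t)\<^sup>2 / 2))"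
    using normal_density_sin_integral(1)[OF s]
    by (subst Bochner_Integration.integral_diff[OF i i]) simp
  finally show ?thesis using t by (simp add: wave_def power_mult_distrib)
qed

text \<open>The weight turns the sine transform of the left side into the mean of
  \<open>wave \<theta>\<close> on survival, known from \<open>survive_wave\<close>. Both measures
  are finite and carried by the positive half-line, so equal sine transforms suffice.\<close>

lemma law_survive:
  assumes t: "t > 0"
  shows "distr (density M (\<lambda>\<omega>. ennreal (indicator (survive t) \<omega> * exp (r * X t \<omega>)))) borel (X t)
    = density lborel (\<lambda>y. ennreal (indicator {0<..} y * dens t y))" (is "?N1 = ?N2")
proof (rule finite_measure_sin_unique)
  note [measurable] = survive_meas[OF t]
  let ?D = "density M (\<lambda>\<omega>. ennreal (indicator (survive t) \<omega> * exp (r * X t \<omega>)))"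
  have X1: "integrable M (\<lambda>\<omega>. exp (r * X t \<omega>))" using X_exp_integrable[OF t, of 1] by simp
  have "integrable M (\<lambda>\<omega>. indicator (survive t) \<omega> * exp (r * X t \<omega>))"
    by (rule Bochner_Integration.integrable_bound[OF X1]) (auto simp: indicator_def)
  then have "(\<integral>\<^sup>+\<omega>. ennreal (indicator (survive t) \<omega> * exp (r * X t \<omega>)) \<partial>M) \<noteq> \<infinity>"
    by (simp add: nn_integral_eq_integral)
  then have "finite_measure ?D"
    by (intro finite_measureI) (simp add: emeasure_density cong: nn_integral_cong)
  then show "finite_measure ?N1" by (rule finite_measure.finite_measure_distr) simp
  have d1: "integrable lborel (\<lambda>y. dens t y * indicator {0<..} y)"
    by (rule dens_test(1)[OF t]) auto
  have nn: "0 \<le> dens t y * indicator {0<..} y" for y using dens_nonneg[OF t, of y] by (auto simp: indicator_def)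
  have "(\<integral>\<^sup>+y. ennreal (dens t y * indicator {0<..} y) \<partial>lborel) \<noteq> \<infinity>"
    using nn_integral_eq_integral[OF d1] nn by simp
  then show "finite_measure ?N2"
    by (intro finite_measureI) (simp add: emeasure_density mult.commute cong: nn_integral_cong)
  show "emeasure ?N2 {..0} = 0"
    by (subst emeasure_density) (auto simp: indicator_def intro!: nn_integral_zero')
  have "AE \<omega> in M. ennreal (indicator (survive t) \<omega> * exp (r * X t \<omega>)) * indicator (X t -` {..0} \<inter> space M) \<omega> = 0"
    using X0_pos AE_space
  proof eventually_elim
    case (elim \<omega>)
    then show ?case using survive_pos[of t \<omega> t] t by (auto simp: indicator_def)
  qed
  then show "emeasure ?N1 {..0} = 0"
    by (simp add: emeasure_distr emeasure_density nn_integral_0_iff_AE)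
  fix \<theta>
  have b: "\<bar>indicator {0<..} y * sin (\<theta> * y)\<bar> \<le> 1" for y :: real by (simp add: indicator_def)
  have "(\<integral>y. sin (\<theta> * y) \<partial>?N1) = (\<integral>\<omega>. indicator (survive t) \<omega> * wave \<theta> (X t \<omega>) \<partial>M)"
    by (simp add: integral_distr integral_density wave_def mult.assoc)
  also have "\<dots> = exp (- rate \<theta> * t) * (\<integral>\<omega>. wave \<theta> (X0 \<omega>) \<partial>M)"
    by (rule survive_wave[OF t])
  \<comment> \<open>The first factor is the prefactor of \<open>dens\<close>, the second the
    Gaussian damping produced by \<open>image_density_sin\<close>.\<close>
  also have "exp (- rate \<theta> * t) = exp (- r\<^sup>2 * t / 2) * exp (- \<theta>\<^sup>2 * t / 2)"
    by (simp add: mult_exp_exp rate_def field_simps)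
  also have "\<dots> * (\<integral>\<omega>. wave \<theta> (X0 \<omega>) \<partial>M) = exp (- r\<^sup>2 * t / 2) * (\<integral>\<omega>. wave \<theta> (X0 \<omega>) * exp (- \<theta>\<^sup>2 * t / 2) \<partial>M)"
    by simp
  also have "\<dots> = (\<integral>y. dens t y * (indicator {0<..} y * sin (\<theta> * y)) \<partial>lborel)"
    by (subst dens_test(2)[OF t]) (simp_all add: image_density_sin[OF t] b)
  also have "\<dots> = (\<integral>y. sin (\<theta> * y) \<partial>?N2)"
    using nn by (subst integral_density) (auto simp: mult_ac)
  finally show "(\<integral>y. sin (\<theta> * y) \<partial>?N1) = (\<integral>y. sin (\<theta> * y) \<partial>?N2)" .
qed simp_all

end

section \<open>Density of the conditional law with respect to the Yaglom law\<close>

locale yaglom_bm = drifted_bm +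
  assumes X0_moment: "integrable M (\<lambda>\<omega>. X0 \<omega> ^ 3 * exp (r * X0 \<omega>))"
begin

lemma X0_moment1: "integrable M (\<lambda>\<omega>. X0 \<omega> * exp (r * X0 \<omega>))"
proof (rule Bochner_Integration.integrable_bound[OF Bochner_Integration.integrable_add[OF X0_moment X0_exp]])
  show "AE \<omega> in M. norm (X0 \<omega> * exp (r * X0 \<omega>)) \<le> norm (X0 \<omega> ^ 3 * exp (r * X0 \<omega>) + exp (r * X0 \<omega>))"
    using X0_pos
  proof eventually_elim
    case (elim \<omega>)
    let ?x = "X0 \<omega>"
    have "?x \<le> ?x ^ 3 + 1"
    proof (cases "?x \<le> 1")
      case False
      then have "?x * 1 \<le> ?x * (?x * ?x)" by (intro mult_left_mono) (auto simp: mult_ge1_I)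
      then show ?thesis by (simp add: power3_eq_cube mult.assoc)
    qed (use elim zero_le_power[of ?x 3] in linarith)
    then have "?x * exp (r * ?x) \<le> (?x ^ 3 + 1) * exp (r * ?x)" by (intro mult_right_mono) auto
    then show ?case using elim by (simp add: distrib_right)
  qed
qed simp

text \<open>The conditional density relative to \<open>yaglom r\<close>, up to normalisation. As the
  kernel tends to 1 it becomes constant in \<open>y\<close>, which is why the Yaglom law is the
  limit.\<close>

definition mass :: "real \<Rightarrow> real \<Rightarrow> real" where
  "mass t y = (\<integral>\<omega>. X0 \<omega> * exp (r * X0 \<omega>) * kernel t (X0 \<omega>) y \<partial>M)"

lemma mass_meas [measurable]: "mass t \<in> borel_measurable borel"
  unfolding mass_def kernel_def sinh_field_def by measurable

lemma kernel_meas [measurable]: "(\<lambda>\<omega>. kernel t (X0 \<omega>) y) \<in> borel_measurable M"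
  unfolding kernel_def sinh_field_def by measurable

lemma kernel_integrable:
  assumes t: "t > 0" and y: "y > 0"
  shows "integrable M (\<lambda>\<omega>. X0 \<omega> * exp (r * X0 \<omega>) * kernel t (X0 \<omega>) y)"
proof (rule Bochner_Integration.integrable_bound[OF X0_moment1])
  show "AE \<omega> in M. norm (X0 \<omega> * exp (r * X0 \<omega>) * kernel t (X0 \<omega>) y) \<le> norm (X0 \<omega> * exp (r * X0 \<omega>))"
    using X0_pos
  proof eventually_elim
    case (elim \<omega>)
    then show ?case using kernel_bounds[OF t elim y] by (simp add: abs_mult mult_left_le)
  qed
qed simp

definition norm_const :: "real \<Rightarrow> real" where
  "norm_const t = exp (- r\<^sup>2 * t / 2) * (2 / (t * sqrt (2 * pi * t))) / r\<^sup>2"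

lemma norm_const_pos: "t > 0 \<Longrightarrow> norm_const t > 0"
  using r by (simp add: norm_const_def)

text \<open>The factor \<open>exp (- r * y)\<close> undoes the weight of \<open>dens\<close>.
  Together with the \<open>y\<close> from \<open>normal_density_reflect_diff\<close> it forms the
  Yaglom density; everything independent of \<open>y\<close> is collected in
  \<open>norm_const\<close>.\<close>

lemma dens_eq:
  assumes t: "t > 0" and y: "y > 0"
  shows "exp (- r * y) * dens t y = (r\<^sup>2 * y * exp (- r * y)) * (norm_const t * mass t y)"
proof -
  have "(\<integral>\<omega>. image_density t y \<omega> \<partial>M) = (\<integral>\<omega>. 2 / (t * sqrt (2 * pi * t)) * y * (X0 \<omega> * exp (r * X0 \<omega>) * kernel t (X0 \<omega>) y) \<partial>M)"
  proof (rule integral_cong_AE)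
    show "AE \<omega> in M. image_density t y \<omega> = 2 / (t * sqrt (2 * pi * t)) * y * (X0 \<omega> * exp (r * X0 \<omega>) * kernel t (X0 \<omega>) y)"
      using X0_pos
      by eventually_elim (simp add: image_density_def normal_density_reflect_diff t y mult_ac)
  qed (auto simp: image_density_def normal_density_def)
  then show ?thesis
    using r by (simp add: dens_def norm_const_def mass_def)
qed

lemma mass_nonneg:
  assumes t: "t > 0" and y: "y > 0"
  shows "0 \<le> mass t y"
  unfolding mass_def
proof (rule integral_nonneg_AE)
  show "AE \<omega> in M. 0 \<le> X0 \<omega> * exp (r * X0 \<omega>) * kernel t (X0 \<omega>) y"
    using X0_pos by eventually_elim (use kernel_bounds(1)[OF t _ y] in simp)
qed

lemma nn_integral_survive:
  assumes t: "t > 0" and f[measurable]: "f \<in> borel_measurable borel"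
  shows "(\<integral>\<^sup>+\<omega>. indicator (survive t) \<omega> * f (X t \<omega>) \<partial>M) = (\<integral>\<^sup>+y. ennreal (norm_const t * mass t y) * f y \<partial>yaglom r)"
proof -
  note [measurable] = survive_meas[OF t]
  let ?D = "density M (\<lambda>\<omega>. ennreal (indicator (survive t) \<omega> * exp (r * X t \<omega>)))"
  let ?e = "\<lambda>y. ennreal (exp (- r * y)) * f y"
  have "(\<integral>\<^sup>+\<omega>. indicator (survive t) \<omega> * f (X t \<omega>) \<partial>M)
    = (\<integral>\<^sup>+\<omega>. ennreal (indicator (survive t) \<omega> * exp (r * X t \<omega>)) * ?e (X t \<omega>) \<partial>M)"
    by (intro nn_integral_cong)
      (auto simp: indicator_def mult.assoc[symmetric] ennreal_mult[symmetric] mult_exp_exp)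
  also have "\<dots> = (\<integral>\<^sup>+y. ?e y \<partial>distr ?D borel (X t))"
    by (simp add: nn_integral_distr nn_integral_density)
  also have "\<dots> = (\<integral>\<^sup>+y. ennreal (indicator {0<..} y * dens t y) * ?e y \<partial>lborel)"
    unfolding law_survive[OF t] by (simp add: nn_integral_density)
  also have "\<dots> = (\<integral>\<^sup>+y. ennreal (indicator {0<..} y * r\<^sup>2 * y * exp (- r * y)) * (ennreal (norm_const t * mass t y) * f y) \<partial>lborel)"
  proof (intro nn_integral_cong)
    fix y
    show "ennreal (indicator {0<..} y * dens t y) * ?e y = ennreal (indicator {0<..} y * r\<^sup>2 * y * exp (- r * y)) * (ennreal (norm_const t * mass t y) * f y)"
    proof (cases "y > 0")
      case True
      have "ennreal (dens t y) * (ennreal (exp (- r * y)) * f y) = ennreal (exp (- r * y) * dens t y) * f y"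
        using dens_nonneg[OF t True] by (subst ennreal_mult) (auto simp: mult_ac)
      also have "\<dots> = ennreal (r\<^sup>2 * y * exp (- r * y)) * (ennreal (norm_const t * mass t y) * f y)"
        unfolding dens_eq[OF t True] using mass_nonneg[OF t True] norm_const_pos[OF t] True
        by (subst ennreal_mult) (auto simp: mult_ac)
      finally show ?thesis using True by simp
    qed simp
  qed
  also have "\<dots> = (\<integral>\<^sup>+y. ennreal (norm_const t * mass t y) * f y \<partial>yaglom r)"
    unfolding yaglom_def by (subst nn_integral_density) auto
  finally show ?thesis .
qed

lemma mass_le:
  assumes t: "t > 0" and y: "y > 0"
  shows "mass t y \<le> (\<integral>\<omega>. X0 \<omega> * exp (r * X0 \<omega>) \<partial>M)"
  unfolding mass_def
proof (rule integral_mono_AE[OF kernel_integrable[OF t y] X0_moment1])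
  show "AE \<omega> in M. X0 \<omega> * exp (r * X0 \<omega>) * kernel t (X0 \<omega>) y \<le> X0 \<omega> * exp (r * X0 \<omega>)"
    using X0_pos by eventually_elim (use kernel_bounds(2)[OF t _ y] in \<open>simp add: mult_left_le\<close>)
qed

lemma mass_integrable:
  assumes t: "t > 0"
  shows "integrable (yaglom r) (mass t)"
proof -
  interpret Y: prob_space "yaglom r" using r by (rule prob_space_yaglom)
  show ?thesis
  proof (rule Y.integrable_const_bound)
    show "AE y in yaglom r. norm (mass t y) \<le> (\<integral>\<omega>. X0 \<omega> * exp (r * X0 \<omega>) \<partial>M)"
      using AE_yaglom by eventually_elim (use mass_nonneg[OF t] mass_le[OF t] in simp)
  qed simp
qed

lemma cond_law_density:
  assumes t: "t > 0" and pos: "(\<integral>y. mass t y \<partial>yaglom r) > 0"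
  shows "cond_law M X t = density (yaglom r) (\<lambda>y. ennreal (mass t y / (\<integral>y. mass t y \<partial>yaglom r)))"
proof (rule measure_eqI)
  note [measurable] = survive_meas[OF t]
  let ?I = "\<integral>y. mass t y \<partial>yaglom r"
  fix A assume "A \<in> sets (cond_law M X t)"
  then have A[measurable]: "A \<in> sets borel" by (simp add: cond_law_def)
  have nn: "AE y in yaglom r. 0 \<le> mass t y"
    using AE_yaglom by eventually_elim (use mass_nonneg[OF t] in simp)
  \<comment> \<open>Used for \<open>A\<close> and for \<open>UNIV\<close>; the common factor
    \<open>norm_const t\<close> cancels in the conditional probability.\<close>
  have E: "emeasure M (survive t \<inter> (X t -` S \<inter> space M)) = ennreal (norm_const t * (\<integral>y. mass t y * indicator S y \<partial>yaglom r))"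
    if [measurable]: "S \<in> sets borel" for S
  proof -
    have "emeasure M (survive t \<inter> (X t -` S \<inter> space M)) = (\<integral>\<^sup>+\<omega>. indicator (survive t \<inter> (X t -` S \<inter> space M)) \<omega> \<partial>M)"
      by (rule nn_integral_indicator[symmetric]) measurable
    also have "\<dots> = (\<integral>\<^sup>+\<omega>. indicator (survive t) \<omega> * indicator S (X t \<omega>) \<partial>M)"
      by (intro nn_integral_cong) (auto simp: indicator_def)
    also have "\<dots> = (\<integral>\<^sup>+y. ennreal (norm_const t * mass t y) * indicator S y \<partial>yaglom r)"
      by (rule nn_integral_survive[OF t]) simp
    also have "\<dots> = (\<integral>\<^sup>+y. ennreal (norm_const t * (mass t y * indicator S y)) \<partial>yaglom r)"
      by (intro nn_integral_cong) (simp add: indicator_def)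
    also have "\<dots> = ennreal (\<integral>y. norm_const t * (mass t y * indicator S y) \<partial>yaglom r)"
    proof (rule nn_integral_eq_integral)
      show "integrable (yaglom r) (\<lambda>y. norm_const t * (mass t y * indicator S y))"
        by (intro integrable_mult_right integrable_real_mult_indicator mass_integrable t) simp
      show "AE y in yaglom r. 0 \<le> norm_const t * (mass t y * indicator S y)"
        using nn by eventually_elim (use norm_const_pos[OF t] in simp)
    qed
    finally show ?thesis by simp
  qed
  have S: "emeasure M (survive t) = ennreal (norm_const t * ?I)"
    using E[of UNIV] by (simp add: survive_def Int_absorb2 Collect_conj_eq)
  have Snn: "0 \<le> (\<integral>y. mass t y * indicator A y \<partial>yaglom r)"
    by (rule integral_nonneg_AE) (use nn in eventually_elim, simp)
  have "emeasure (cond_law M X t) A = emeasure M (survive t \<inter> (X t -` A \<inter> space M)) / emeasure M (survive t)"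
    unfolding cond_law_def survive_def[symmetric]
    by (subst emeasure_distr) (auto simp: uniform_measure_def[symmetric])
  also have "\<dots> = ennreal ((\<integral>y. mass t y * indicator A y \<partial>yaglom r) / ?I)"
    unfolding E[OF A] S using pos norm_const_pos[OF t] Snn by (subst divide_ennreal) auto
  also have "\<dots> = ennreal (\<integral>y. mass t y * indicator A y / ?I \<partial>yaglom r)" by simp
  also have "\<dots> = (\<integral>\<^sup>+y. ennreal (mass t y * indicator A y / ?I) \<partial>yaglom r)"
  proof (rule nn_integral_eq_integral[symmetric])
    show "integrable (yaglom r) (\<lambda>y. mass t y * indicator A y / ?I)"
      by (intro integrable_divide integrable_real_mult_indicator mass_integrable t) simp
    show "AE y in yaglom r. 0 \<le> mass t y * indicator A y / ?I"
      using nn by eventually_elim (use pos in simp)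
  qed
  also have "\<dots> = emeasure (density (yaglom r) (\<lambda>y. ennreal (mass t y / ?I))) A"
    by (subst emeasure_density) (auto intro!: nn_integral_cong simp: indicator_def)
  finally show "emeasure (cond_law M X t) A = emeasure (density (yaglom r) (\<lambda>y. ennreal (mass t y / ?I))) A" .
qed (simp add: cond_law_def)

end

section \<open>The rate of convergence\<close>

text \<open>First-order expansion in 1/t: the Gaussian factor contributes (x^2 + y^2)/2, while sinh
  z / z differs from 1 only by order z^2, hence by order 1/t^2.\<close>

lemma kernel_deficit_tendsto:
  assumes "x > 0" "y > 0"
  shows "((\<lambda>t. t * (1 - kernel t x y)) \<longlongrightarrow> (x\<^sup>2 + y\<^sup>2) / 2) at_top"
proof -
  have lim: "((\<lambda>t. t * (1 - exp (- a / t) * ((exp (b / t) - exp (- (b / t))) / 2 / (b / t)))) \<longlongrightarrow> a) at_top"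
    if "a > 0" "b > 0" for a b :: real
    using that by real_asymp
  have e: "- ((x\<^sup>2 + y\<^sup>2) / 2) / t = - (x\<^sup>2 + y\<^sup>2) / (2 * t)" for t
    by (simp only: minus_divide_left divide_divide_eq_left)
  have "kernel t x y = exp (- ((x\<^sup>2 + y\<^sup>2) / 2) / t) * ((exp (x * y / t) - exp (- (x * y / t))) / 2 / (x * y / t))" for t
    unfolding kernel_def sinh_field_def e ..
  moreover have "0 < (x\<^sup>2 + y\<^sup>2) / 2" "0 < x * y" using assms by (auto intro: add_pos_pos)
  ultimately show ?thesis using lim by (simp only:)
qed

section \<open>Asymptotics of the deviation from a constant density\<close>

context yaglom_bm begin

definition m1 :: real where "m1 = (\<integral>\<omega>. X0 \<omega> * exp (r * X0 \<omega>) \<partial>M)"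
definition m3 :: real where "m3 = (\<integral>\<omega>. X0 \<omega> ^ 3 * exp (r * X0 \<omega>) \<partial>M)"

lemma m1_pos: "m1 > 0"
proof -
  have "0 \<le> m1" unfolding m1_def by (rule integral_nonneg_AE) (use X0_pos in eventually_elim, simp)
  moreover have "m1 \<noteq> 0"
  proof
    assume "m1 = 0"
    then have "AE \<omega> in M. X0 \<omega> * exp (r * X0 \<omega>) = 0"
      unfolding m1_def using X0_pos by (subst (asm) integral_nonneg_eq_0_iff_AE[OF X0_moment1]) auto
    then have "AE \<omega> in M. False" using X0_pos by eventually_elim simp
    then show False by simp
  qed
  ultimately show ?thesis by simp
qed

definition deficit :: "real \<Rightarrow> real \<Rightarrow> real" where
  "deficit t y = m1 - mass t y"

lemma deficit_meas [measurable]: "deficit t \<in> borel_measurable borel"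
  unfolding deficit_def by measurable

lemma deficit_eq:
  assumes t: "t > 0" and y: "y > 0"
  shows "deficit t y = (\<integral>\<omega>. X0 \<omega> * exp (r * X0 \<omega>) * (1 - kernel t (X0 \<omega>) y) \<partial>M)"
  unfolding deficit_def m1_def mass_def
  by (subst Bochner_Integration.integral_diff[OF X0_moment1 kernel_integrable[OF t y], symmetric])
     (simp add: right_diff_distrib)

text \<open>Both the upper bound and the limit of \<open>t * deficit t y\<close>. The cubic moment
  assumption is what makes \<open>m3\<close> a genuine integral here.\<close>

definition envelope :: "real \<Rightarrow> real" where
  "envelope y = (m3 + y\<^sup>2 * m1) / 2"

lemma X0_envelope:
  "integrable M (\<lambda>\<omega>. X0 \<omega> * exp (r * X0 \<omega>) * (((X0 \<omega>)\<^sup>2 + y\<^sup>2) / 2))"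
  "(\<integral>\<omega>. X0 \<omega> * exp (r * X0 \<omega>) * (((X0 \<omega>)\<^sup>2 + y\<^sup>2) / 2) \<partial>M) = envelope y"
proof -
  have e: "X0 \<omega> * exp (r * X0 \<omega>) * (((X0 \<omega>)\<^sup>2 + y\<^sup>2) / 2)
    = (X0 \<omega> ^ 3 * exp (r * X0 \<omega>) + y\<^sup>2 * (X0 \<omega> * exp (r * X0 \<omega>))) / 2" for \<omega>
    by (simp add: power2_eq_square power3_eq_cube algebra_simps)
  show "integrable M (\<lambda>\<omega>. X0 \<omega> * exp (r * X0 \<omega>) * (((X0 \<omega>)\<^sup>2 + y\<^sup>2) / 2))"
    unfolding e by (intro integrable_divide Bochner_Integration.integrable_add integrable_mult_right X0_moment X0_moment1)
  show "(\<integral>\<omega>. X0 \<omega> * exp (r * X0 \<omega>) * (((X0 \<omega>)\<^sup>2 + y\<^sup>2) / 2) \<partial>M) = envelope y"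
    unfolding e envelope_def m1_def m3_def
    by (simp add: Bochner_Integration.integral_add[OF X0_moment integrable_mult_right[OF X0_moment1]])
qed

text \<open>Dominated convergence over the initial value, in which the limit \<open>?w\<close> of
  the integrands is also their dominating function.\<close>

lemma scaled_deficit:
  assumes y: "y > 0"
  shows "t > 0 \<Longrightarrow> 0 \<le> deficit t y" and "t > 0 \<Longrightarrow> t * deficit t y \<le> envelope y"
    and "((\<lambda>t. t * deficit t y) \<longlongrightarrow> envelope y) at_top"
proof -
  let ?w = "\<lambda>\<omega>. X0 \<omega> * exp (r * X0 \<omega>) * (((X0 \<omega>)\<^sup>2 + y\<^sup>2) / 2)"
  let ?d = "\<lambda>t \<omega>. X0 \<omega> * exp (r * X0 \<omega>) * (t * (1 - kernel t (X0 \<omega>) y))"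
  have d: "AE \<omega> in M. 0 \<le> ?d t \<omega> \<and> ?d t \<omega> \<le> ?w \<omega>" if t: "t > 0" for t
    using X0_pos
  proof eventually_elim
    case (elim \<omega>)
    have "t * (1 - kernel t (X0 \<omega>) y) \<le> t * (((X0 \<omega>)\<^sup>2 + y\<^sup>2) / (2 * t))"
      using kernel_bounds(3)[OF t elim y] t by (intro mult_left_mono) auto
    also have "\<dots> = ((X0 \<omega>)\<^sup>2 + y\<^sup>2) / 2" using t by simp
    finally show ?case using elim kernel_bounds(2)[OF t elim y] t
      by (intro conjI mult_left_mono mult_nonneg_nonneg) auto
  qed
  have eq: "t * deficit t y = (\<integral>\<omega>. ?d t \<omega> \<partial>M)" if "t > 0" for t
    unfolding deficit_eq[OF that y] integral_mult_right_zero[symmetric] by (simp add: mult_ac)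
  have di: "integrable M (?d t)" if t: "t > 0" for t
    by (rule Bochner_Integration.integrable_bound[OF X0_envelope(1)[of y]]) (use d[OF t] in auto)
  { assume t: "t > 0"
    have "0 \<le> t * deficit t y"
      unfolding eq[OF t] by (rule integral_nonneg_AE) (use d[OF t] in eventually_elim, simp)
    then show "0 \<le> deficit t y" using t by (simp add: zero_le_mult_iff)
    show "t * deficit t y \<le> envelope y"
      unfolding eq[OF t] X0_envelope(2)[symmetric]
      by (rule integral_mono_AE[OF di[OF t] X0_envelope(1)]) (use d[OF t] in eventually_elim, simp) }
  have "((\<lambda>t. \<integral>\<omega>. ?d t \<omega> \<partial>M) \<longlongrightarrow> (\<integral>\<omega>. ?w \<omega> \<partial>M)) at_top"
  proof (rule integral_dominated_convergence_at_top[where w="?w"])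
    show "\<forall>\<^sub>F t in at_top. AE \<omega> in M. norm (?d t \<omega>) \<le> ?w \<omega>"
      using eventually_gt_at_top[of 0]
    proof eventually_elim
      case (elim t)
      from d[OF elim] show ?case by eventually_elim simp
    qed
    show "AE \<omega> in M. ((\<lambda>t. ?d t \<omega>) \<longlongrightarrow> ?w \<omega>) at_top"
      using X0_pos by eventually_elim (intro tendsto_intros kernel_deficit_tendsto y)
  qed (use X0_envelope(1) in auto)
  then have "((\<lambda>t. \<integral>\<omega>. ?d t \<omega> \<partial>M) \<longlongrightarrow> envelope y) at_top"
    unfolding X0_envelope(2) .
  moreover have "\<forall>\<^sub>F t in at_top. (\<integral>\<omega>. ?d t \<omega> \<partial>M) = t * deficit t y"
    using eventually_gt_at_top[of 0] by eventually_elim (simp add: eq)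
  ultimately show "((\<lambda>t. t * deficit t y) \<longlongrightarrow> envelope y) at_top"
    by (rule Lim_transform_eventually)
qed

lemma yaglom_prob: "prob_space (yaglom r)"
  using r by (rule prob_space_yaglom)

lemma envelope_moment:
  "integrable (yaglom r) (\<lambda>y. y ^ k * envelope y)"
  "(\<integral>y. y ^ k * envelope y \<partial>yaglom r) = (m3 * fact (Suc k) / r ^ k + m1 * fact (k + 3) / r ^ (k + 2)) / 2"
proof -
  have e: "y ^ k * envelope y = (m3 * y ^ k + m1 * y ^ (k + 2)) / 2" for y
    by (simp add: envelope_def power_add power2_eq_square algebra_simps)
  note i = integrable_mult_right[OF yaglom_moments(1)[OF r]]
  show "integrable (yaglom r) (\<lambda>y. y ^ k * envelope y)"
    unfolding e by (intro integrable_divide Bochner_Integration.integrable_add i)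
  show "(\<integral>y. y ^ k * envelope y \<partial>yaglom r) = (m3 * fact (Suc k) / r ^ k + m1 * fact (k + 3) / r ^ (k + 2)) / 2"
    unfolding e integral_divide_zero Bochner_Integration.integral_add[OF i i] integral_mult_right_zero yaglom_moments(2)[OF r]
    by (simp add: eval_nat_numeral)
qed

text \<open>The same scheme once more, now integrating over \<open>y\<close>. Exponent 0 serves the
  normalisation, exponent 1 the Lipschitz test functions.\<close>

lemma deficit_moment:
  shows "t > 0 \<Longrightarrow> integrable (yaglom r) (\<lambda>y. y ^ k * deficit t y)"
    and "t > 0 \<Longrightarrow> 0 \<le> (\<integral>y. y ^ k * deficit t y \<partial>yaglom r)"
    and "t > 0 \<Longrightarrow> t * (\<integral>y. y ^ k * deficit t y \<partial>yaglom r) \<le> (\<integral>y. y ^ k * envelope y \<partial>yaglom r)"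
    and "((\<lambda>t. t * (\<integral>y. y ^ k * deficit t y \<partial>yaglom r)) \<longlongrightarrow> (\<integral>y. y ^ k * envelope y \<partial>yaglom r)) at_top"
proof -
  have [measurable]: "envelope \<in> borel_measurable borel" unfolding envelope_def by measurable
  have b: "AE y in yaglom r. 0 \<le> y ^ k * (t * deficit t y) \<and> y ^ k * (t * deficit t y) \<le> y ^ k * envelope y" if t: "t > 0" for t
    using AE_yaglom
    by eventually_elim (use t scaled_deficit in \<open>auto intro!: mult_left_mono mult_nonneg_nonneg\<close>)
  have it: "integrable (yaglom r) (\<lambda>y. y ^ k * (t * deficit t y))" if t: "t > 0" for t
    by (rule Bochner_Integration.integrable_bound[OF envelope_moment(1)[of k]]) (use b[OF t] in auto)
  { assume t: "t > 0"
    have "integrable (yaglom r) (\<lambda>y. (1 / t) * (y ^ k * (t * deficit t y)))"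
      by (intro integrable_mult_right it t)
    then show "integrable (yaglom r) (\<lambda>y. y ^ k * deficit t y)" using t by simp
    show "0 \<le> (\<integral>y. y ^ k * deficit t y \<partial>yaglom r)"
      by (rule integral_nonneg_AE)
        (use AE_yaglom in eventually_elim, use t scaled_deficit in \<open>auto intro!: mult_nonneg_nonneg\<close>)
    have "t * (\<integral>y. y ^ k * deficit t y \<partial>yaglom r) = (\<integral>y. y ^ k * (t * deficit t y) \<partial>yaglom r)"
      unfolding integral_mult_right_zero[symmetric] by (simp add: mult_ac)
    also have "\<dots> \<le> (\<integral>y. y ^ k * envelope y \<partial>yaglom r)"
      by (rule integral_mono_AE[OF it[OF t] envelope_moment(1)]) (use b[OF t] in eventually_elim, simp)
    finally show "t * (\<integral>y. y ^ k * deficit t y \<partial>yaglom r) \<le> (\<integral>y. y ^ k * envelope y \<partial>yaglom r)" . }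
  have "((\<lambda>t. \<integral>y. y ^ k * (t * deficit t y) \<partial>yaglom r) \<longlongrightarrow> (\<integral>y. y ^ k * envelope y \<partial>yaglom r)) at_top"
  proof (rule integral_dominated_convergence_at_top[where w="\<lambda>y. y ^ k * envelope y"])
    show "\<forall>\<^sub>F t in at_top. AE y in yaglom r. norm (y ^ k * (t * deficit t y)) \<le> y ^ k * envelope y"
      using eventually_gt_at_top[of 0]
    proof eventually_elim
      case (elim t)
      from b[OF elim] show ?case by eventually_elim simp
    qed
    show "AE y in yaglom r. ((\<lambda>t. y ^ k * (t * deficit t y)) \<longlongrightarrow> y ^ k * envelope y) at_top"
      using AE_yaglom by eventually_elim (intro tendsto_intros scaled_deficit)
  qed (use envelope_moment(1) in auto)
  also have "(\<lambda>t. \<integral>y. y ^ k * (t * deficit t y) \<partial>yaglom r) = (\<lambda>t. t * (\<integral>y. y ^ k * deficit t y \<partial>yaglom r))"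
    unfolding integral_mult_right_zero[symmetric] by (simp add: mult_ac)
  finally show "((\<lambda>t. t * (\<integral>y. y ^ k * deficit t y \<partial>yaglom r)) \<longlongrightarrow> (\<integral>y. y ^ k * envelope y \<partial>yaglom r)) at_top" .
qed

definition total :: "real \<Rightarrow> real" where
  "total t = (\<integral>y. mass t y \<partial>yaglom r)"

text \<open>The factor \<open>y ^ 0\<close> keeps the integral in the shape of
  \<open>deficit_moment\<close> with \<open>k = 0\<close>.\<close>

lemma total_eq:
  assumes t: "t > 0"
  shows "total t = m1 - (\<integral>y. y ^ 0 * deficit t y \<partial>yaglom r)"
proof -
  interpret Y: prob_space "yaglom r" by (rule yaglom_prob)
  have "(\<integral>y. deficit t y \<partial>yaglom r) = m1 - total t"
    unfolding deficit_def total_def by (subst Bochner_Integration.integral_diff) (use mass_integrable[OF t] in \<open>auto simp: Y.prob_space[simplified]\<close>)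
  then show ?thesis by simp
qed

lemma total_tendsto: "(total \<longlongrightarrow> m1) at_top"
proof -
  let ?e = "\<lambda>t. \<integral>y. y ^ 0 * deficit t y \<partial>yaglom r"
  have "((\<lambda>t. m1 - (1 / t) * (t * ?e t)) \<longlongrightarrow> m1 - 0 * (\<integral>y. y ^ 0 * envelope y \<partial>yaglom r)) at_top"
    by (intro tendsto_intros deficit_moment(4)) real_asymp
  moreover have "\<forall>\<^sub>F t in at_top. m1 - (1 / t) * (t * ?e t) = total t"
    using eventually_gt_at_top[of 0] by eventually_elim (simp add: total_eq)
  ultimately show ?thesis by (simp add: Lim_transform_eventually)
qed

section \<open>Test functions and the Wasserstein distance\<close>

definition lip :: "(real \<Rightarrow> real) set" where
  "lip = {f :: real \<Rightarrow> real. f \<in> borel_measurable borel \<and> f 0 = 1 \<and>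
                   (\<forall>x y. 0 \<le> x \<longrightarrow> 0 \<le> y \<longrightarrow> \<bar>f x - f y\<bar> \<le> \<bar>x - y\<bar>)}"

text \<open>The difference of means is minus the Yaglom covariance of \<open>f\<close> and
  \<open>deficit t\<close>, divided by \<open>total t\<close>. Constants drop out of a covariance,
  so \<open>f\<close> is replaced by \<open>f - 1\<close>, which is dominated by the identity on the
  positive half-line.\<close>

lemma lip_diff:
  assumes t: "t > 0" and pos: "total t > 0" and f: "f \<in> lip"
  shows "integrable (yaglom r) (\<lambda>y. (f y - 1) * deficit t y)"
    and "\<bar>\<integral>y. (f y - 1) * deficit t y \<partial>yaglom r\<bar> \<le> (\<integral>y. y ^ 1 * deficit t y \<partial>yaglom r)"
    and "\<bar>\<integral>y. f y - 1 \<partial>yaglom r\<bar> \<le> (\<integral>y. y ^ 1 \<partial>yaglom r)"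
    and "(\<integral>y. f y \<partial>cond_law M X t) - (\<integral>y. f y \<partial>yaglom r)
     = ((\<integral>y. f y - 1 \<partial>yaglom r) * (\<integral>y. y ^ 0 * deficit t y \<partial>yaglom r) - (\<integral>y. (f y - 1) * deficit t y \<partial>yaglom r)) / total t"
proof -
  interpret Y: prob_space "yaglom r" by (rule yaglom_prob)
  have [measurable]: "f \<in> borel_measurable borel" and f0: "f 0 = 1" using f by (auto simp: lip_def)
  have g: "\<bar>f y - 1\<bar> \<le> y" if "y > 0" for y
  proof -
    have "\<bar>f y - f 0\<bar> \<le> \<bar>y - 0\<bar>" using f that unfolding lip_def by (blast intro: less_imp_le)
    then show ?thesis using f0 that by simp
  qed
  have gd: "AE y in yaglom r. norm ((f y - 1) * deficit t y) \<le> y ^ 1 * deficit t y"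
    using AE_yaglom by eventually_elim (use g scaled_deficit(1)[OF _ t] in \<open>auto simp: abs_mult intro!: mult_right_mono\<close>)
  have g1: "AE y in yaglom r. norm (f y - 1) \<le> y ^ 1"
    using AE_yaglom by eventually_elim (use g in auto)
  show i1: "integrable (yaglom r) (\<lambda>y. (f y - 1) * deficit t y)"
    by (rule Bochner_Integration.integrable_bound[OF deficit_moment(1)[OF t, of 1]]) (use gd in auto)
  have i2: "integrable (yaglom r) (\<lambda>y. f y - 1)"
    by (rule Bochner_Integration.integrable_bound[OF yaglom_moments(1)[OF r, of 1]]) (use g1 in auto)
  then have i3: "integrable (yaglom r) f"
    using Bochner_Integration.integrable_add[OF i2, of "\<lambda>_. 1"] by simp
  show "\<bar>\<integral>y. (f y - 1) * deficit t y \<partial>yaglom r\<bar> \<le> (\<integral>y. y ^ 1 * deficit t y \<partial>yaglom r)"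
    using gd by (intro order_trans[OF integral_abs_bound] integral_mono_AE integrable_abs i1 deficit_moment(1)[OF t]) auto
  show "\<bar>\<integral>y. f y - 1 \<partial>yaglom r\<bar> \<le> (\<integral>y. y ^ 1 \<partial>yaglom r)"
    using g1 by (intro order_trans[OF integral_abs_bound] integral_mono_AE integrable_abs i2 yaglom_moments(1)[OF r]) auto
  have mnn: "AE y in yaglom r. 0 \<le> mass t y / total t"
    using AE_yaglom by eventually_elim (use mass_nonneg[OF t] pos in simp)
  have "(\<integral>y. f y \<partial>cond_law M X t) = (\<integral>y. mass t y / total t * f y \<partial>yaglom r)"
    unfolding cond_law_density[OF t pos[unfolded total_def]] total_def[symmetric]
    using mnn by (subst integral_density) auto
  \<comment> \<open>Write \<open>f y\<close> as \<open>(f y - 1) + 1\<close>, and replace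
    \<open>mass\<close> by \<open>m1 - deficit\<close> in the first product only.\<close>
  also have "\<dots> = (\<integral>y. (m1 * (f y - 1) - (f y - 1) * deficit t y + mass t y) / total t \<partial>yaglom r)"
    by (intro Bochner_Integration.integral_cong refl) (simp add: deficit_def algebra_simps add_divide_distrib)
  also have "\<dots> = (m1 * (\<integral>y. f y - 1 \<partial>yaglom r) - (\<integral>y. (f y - 1) * deficit t y \<partial>yaglom r) + total t) / total t"
    unfolding integral_divide_zero
      Bochner_Integration.integral_add[OF Bochner_Integration.integrable_diff[OF integrable_mult_right[OF i2] i1] mass_integrable[OF t]]
      Bochner_Integration.integral_diff[OF integrable_mult_right[OF i2] i1] integral_mult_right_zero total_def ..
  finally have c: "(\<integral>y. f y \<partial>cond_law M X t) = (m1 * (\<integral>y. f y - 1 \<partial>yaglom r) - (\<integral>y. (f y - 1) * deficit t y \<partial>yaglom r) + total t) / total t" .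
  have e: "(\<integral>y. f y \<partial>yaglom r) = (\<integral>y. f y - 1 \<partial>yaglom r) + 1"
    using i3 by (subst Bochner_Integration.integral_diff) (auto simp: Y.prob_space[simplified])
  have m: "m1 = total t + (\<integral>y. y ^ 0 * deficit t y \<partial>yaglom r)" using total_eq[OF t] by simp
  show "(\<integral>y. f y \<partial>cond_law M X t) - (\<integral>y. f y \<partial>yaglom r)
     = ((\<integral>y. f y - 1 \<partial>yaglom r) * (\<integral>y. y ^ 0 * deficit t y \<partial>yaglom r) - (\<integral>y. (f y - 1) * deficit t y \<partial>yaglom r)) / total t"
    unfolding c e m using pos by (simp add: field_simps)
qed

lemma W1_lip: "W1 \<alpha> \<beta> = (SUP f\<in>lip. ereal \<bar>(\<integral>x. f x \<partial>\<alpha>) - (\<integral>x. f x \<partial>\<beta>)\<bar>)"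
  unfolding W1_def lip_def ..

abbreviation "env k \<equiv> \<integral>y. y ^ k * envelope y \<partial>yaglom r"

text \<open>The bounds of \<open>lip_diff\<close> depend on \<open>f\<close> only through its
  Lipschitz constant, so they are uniform over the supremum; \<open>deficit_moment\<close> supplies
  the factor 1/t.\<close>

lemma W1_upper:
  assumes t: "t > 0" and pos: "total t > m1 / 2"
  shows "ereal t * W1 (cond_law M X t) (yaglom r) \<le> ereal (2 * ((\<integral>y. y ^ 1 \<partial>yaglom r) * env 0 + env 1) / m1)"
proof -
  have tp: "total t > 0" using pos m1_pos by linarith
  let ?C = "(\<integral>y. y ^ 1 \<partial>yaglom r) * env 0 + env 1"
  have ynn: "0 \<le> (\<integral>y. y ^ 1 \<partial>yaglom r)" unfolding yaglom_moments(2)[OF r] using r by simp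
  have "\<bar>(\<integral>x. f x \<partial>cond_law M X t) - (\<integral>x. f x \<partial>yaglom r)\<bar> \<le> 2 * ?C / m1 / t" if f: "f \<in> lip" for f
  proof -
    define a b where "a = (\<integral>y. f y - 1 \<partial>yaglom r)" and "b = (\<integral>y. (f y - 1) * deficit t y \<partial>yaglom r)"
    define d0 d1 where "d0 = (\<integral>y. y ^ 0 * deficit t y \<partial>yaglom r)" and "d1 = (\<integral>y. y ^ 1 * deficit t y \<partial>yaglom r)"
    note L = lip_diff[OF t tp f, folded a_def b_def d0_def d1_def]
    have d0: "0 \<le> d0" "t * d0 \<le> env 0" "t * d1 \<le> env 1"
      unfolding d0_def d1_def by (intro deficit_moment t)+
    have "\<bar>a * d0 - b\<bar> \<le> \<bar>a * d0\<bar> + \<bar>b\<bar>" by (rule abs_triangle_ineq4)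
    also have "\<bar>a * d0\<bar> = \<bar>a\<bar> * d0" using d0(1) by (simp add: abs_mult)
    also have "\<bar>a\<bar> * d0 + \<bar>b\<bar> \<le> (\<integral>y. y ^ 1 \<partial>yaglom r) * d0 + d1"
      using L(2,3) d0(1) by (intro add_mono mult_right_mono)
    finally have "t * \<bar>a * d0 - b\<bar> \<le> t * ((\<integral>y. y ^ 1 \<partial>yaglom r) * d0 + d1)"
      using t by (intro mult_left_mono) auto
    also have "\<dots> = (\<integral>y. y ^ 1 \<partial>yaglom r) * (t * d0) + t * d1" by (simp only: distrib_left mult.left_commute)
    also have "\<dots> \<le> ?C"
      using ynn d0 by (intro add_mono mult_left_mono)
    finally have 1: "t * \<bar>a * d0 - b\<bar> \<le> ?C" .
    have "0 \<le> t * \<bar>a * d0 - b\<bar>" using t by simp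
    from this 1 have Cnn: "0 \<le> ?C" by (rule order_trans)
    have "\<bar>a * d0 - b\<bar> \<le> ?C / t" using 1 t by (simp only: pos_le_divide_eq mult.commute)
    \<comment> \<open>The factor 2 in the constant is the price of replacing \<open>total t\<close>
      by \<open>m1 / 2\<close>.\<close>
    then have "\<bar>a * d0 - b\<bar> / total t \<le> (?C / t) / (m1 / 2)"
      using pos m1_pos t Cnn by (intro frac_le divide_nonneg_pos) (simp_all only: half_gt_zero less_imp_le)
    also have "\<dots> = 2 * ?C / m1 / t" by (simp add: algebra_simps)
    finally show ?thesis unfolding L(4) abs_divide using tp by (simp only: abs_of_pos)
  qed
  then have "W1 (cond_law M X t) (yaglom r) \<le> ereal (2 * ?C / m1 / t)"
    unfolding W1_lip by (intro SUP_least) simp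
  then have "ereal t * W1 (cond_law M X t) (yaglom r) \<le> ereal t * ereal (2 * ?C / m1 / t)"
    using t by (intro ereal_mult_left_mono) auto
  also have "\<dots> = ereal (2 * ?C / m1)" using t by simp
  finally show ?thesis .
qed

lemma id_lip: "(\<lambda>y. 1 + y) \<in> lip"
  by (auto simp: lip_def)

text \<open>The constant is half of the limit reached by the single test function
  \<open>1 + y\<close>; any positive number below that limit would serve.\<close>

lemma W1_lower: "\<forall>\<^sub>F t in at_top. ereal (3 / r ^ 3) \<le> ereal t * W1 (cond_law M X t) (yaglom r)"
proof -
  let ?d = "\<lambda>k t. \<integral>y. y ^ k * deficit t y \<partial>yaglom r" and ?m = "\<integral>y. y ^ 1 \<partial>yaglom r"
  have "((\<lambda>t. \<bar>?m * (t * ?d 0 t) - t * ?d 1 t\<bar> / total t) \<longlongrightarrow> \<bar>?m * env 0 - env 1\<bar> / m1) at_top"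
    using m1_pos by (intro tendsto_intros deficit_moment(4) total_tendsto) simp
  moreover have "\<bar>?m * env 0 - env 1\<bar> / m1 = 6 / r ^ 3"
  proof -
    \<comment> \<open>The part of \<open>envelope\<close> constant in \<open>y\<close> drops out of
      the covariance, so \<open>m3\<close> cancels. What remains is minus \<open>m1\<close> times
      the covariance of y and y^2/2 under the Yaglom law, (24 - 12)/(2 r^3).\<close>
    have "?m * env 0 - env 1 = - (6 * m1 / r ^ 3)"
    proof -
      have f: "fact (Suc 1) = (2::real)" "fact (0 + 3) = (6::real)" "fact (1 + 3) = (24::real)" "fact (Suc 0) = (1::real)"
        by (simp_all add: fact_numeral)
      have p: "r ^ (1 + 2) = r ^ 3" "r ^ (0 + 2) = r\<^sup>2" by (simp_all add: eval_nat_numeral)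
      have "2 / r * ((m3 + m1 * 6 / r\<^sup>2) / 2) - (m3 * 2 / r + m1 * 24 / r ^ 3) / 2 = - (6 * m1 / r ^ 3)"
        using r by (simp add: divide_simps) (simp add: power2_eq_square power3_eq_cube algebra_simps)
      then show ?thesis unfolding envelope_moment(2) yaglom_moments(2)[OF r] f p by simp
    qed
    then show ?thesis using m1_pos r by simp
  qed
  ultimately have "((\<lambda>t. \<bar>?m * (t * ?d 0 t) - t * ?d 1 t\<bar> / total t) \<longlongrightarrow> 6 / r ^ 3) at_top" by simp
  moreover have "3 / r ^ 3 < 6 / r ^ 3" using r by (simp add: divide_strict_right_mono)
  ultimately have ev: "\<forall>\<^sub>F t in at_top. 3 / r ^ 3 < \<bar>?m * (t * ?d 0 t) - t * ?d 1 t\<bar> / total t"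
    by (rule order_tendstoD)
  have "\<forall>\<^sub>F t in at_top. 0 < total t" by (rule order_tendstoD(1)[OF total_tendsto m1_pos])
  with ev eventually_gt_at_top[of 0] show ?thesis
  proof eventually_elim
    case (elim t)
    then have t: "t > 0" and tp: "total t > 0" by auto
    let ?D = "(\<integral>x. 1 + x \<partial>cond_law M X t) - (\<integral>x. 1 + x \<partial>yaglom r)"
    have D: "?D = (?m * ?d 0 t - ?d 1 t) / total t"
      using lip_diff(4)[OF t tp id_lip] by simp
    have "t * \<bar>?D\<bar> = \<bar>t * ?D\<bar>" using t by (simp add: abs_mult)
    also have "t * ?D = (?m * (t * ?d 0 t) - t * ?d 1 t) / total t"
      unfolding D by (simp add: algebra_simps)
    also have "\<bar>\<dots>\<bar> = \<bar>?m * (t * ?d 0 t) - t * ?d 1 t\<bar> / total t"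
      using tp by (simp only: abs_divide abs_of_pos)
    finally have "ereal (3 / r ^ 3) \<le> ereal t * ereal \<bar>?D\<bar>" using elim(1) by simp
    also have "\<dots> \<le> ereal t * W1 (cond_law M X t) (yaglom r)"
      unfolding W1_lip using t id_lip by (intro ereal_mult_left_mono SUP_upper) auto
    finally show ?case .
  qed
qed

theorem W1_asymptotics:
  "0 < Liminf at_top (\<lambda>t. ereal t * W1 (cond_law M X t) (yaglom r))"
  "Limsup at_top (\<lambda>t. ereal t * W1 (cond_law M X t) (yaglom r)) < \<infinity>"
proof -
  have "(0::ereal) < ereal (3 / r ^ 3)" using r by simp
  also have "\<dots> \<le> Liminf at_top (\<lambda>t. ereal t * W1 (cond_law M X t) (yaglom r))"
    by (rule Liminf_bounded[OF W1_lower])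
  finally show "0 < Liminf at_top (\<lambda>t. ereal t * W1 (cond_law M X t) (yaglom r))" .
  have "\<forall>\<^sub>F t in at_top. m1 / 2 < total t"
    using m1_pos by (intro order_tendstoD(1)[OF total_tendsto]) simp
  with eventually_gt_at_top[of 0]
  have "\<forall>\<^sub>F t in at_top. ereal t * W1 (cond_law M X t) (yaglom r) \<le> ereal (2 * ((\<integral>y. y ^ 1 \<partial>yaglom r) * env 0 + env 1) / m1)"
    by eventually_elim (rule W1_upper)
  then have "Limsup at_top (\<lambda>t. ereal t * W1 (cond_law M X t) (yaglom r)) \<le> ereal (2 * ((\<integral>y. y ^ 1 \<partial>yaglom r) * env 0 + env 1) / m1)"
    by (rule Limsup_bounded)
  then show "Limsup at_top (\<lambda>t. ereal t * W1 (cond_law M X t) (yaglom r)) < \<infinity>"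
    by (rule le_less_trans) simp
qed

end

theorem theorem3p1:
  fixes r :: real and \<mu> :: "real measure"
    and M :: "'a measure" and B :: "real \<Rightarrow> 'a \<Rightarrow> real" and X0 :: "'a \<Rightarrow> real"
  assumes r: "r > 0"
    and mu_prob: "prob_space \<mu>" and mu_sets: "sets \<mu> = sets borel"
    and mu_pos: "emeasure \<mu> {0<..} = 1"
    and moment: "(\<integral>\<^sup>+ x. ennreal (x ^ 3 * exp (r * x)) \<partial>\<mu>) < \<infinity>"
    and BM: "std_BM M B"
    and X0_meas: "X0 \<in> borel_measurable M"
    and X0_law: "distr M borel X0 = \<mu>"
    and indep: "prob_space.indep_set M (sets (vimage_algebra (space M) X0 borel))
                  (sets (vimage_algebra (space M) (\<lambda>\<omega> t. B t \<omega>) (PiM UNIV (\<lambda>_. borel))))"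
  defines "X \<equiv> (\<lambda>t \<omega>. X0 \<omega> + B t \<omega> - r * t)"
  shows "0 < Liminf at_top (\<lambda>t. ereal t * W1 (cond_law M X t) (yaglom r))
       \<and> Liminf at_top (\<lambda>t. ereal t * W1 (cond_law M X t) (yaglom r))
           \<le> Limsup at_top (\<lambda>t. ereal t * W1 (cond_law M X t) (yaglom r))
       \<and> Limsup at_top (\<lambda>t. ereal t * W1 (cond_law M X t) (yaglom r)) < \<infinity>"
proof -
  interpret prob_space M using BM by (simp add: std_BM_def)
  have "emeasure M (X0 -` {0<..} \<inter> space M) = 1"
    using mu_pos X0_meas unfolding X0_law[symmetric] by (simp add: emeasure_distr)
  then have pos: "AE \<omega> in M. 0 < X0 \<omega>"
    using X0_meas AE_in_set_eq_1[of "X0 -` {0<..} \<inter> space M"] by (simp add: measure_def)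
  have "(\<integral>\<^sup>+\<omega>. ennreal (X0 \<omega> ^ 3 * exp (r * X0 \<omega>)) \<partial>M) < \<infinity>"
    using moment X0_meas unfolding X0_law[symmetric] by (simp add: nn_integral_distr)
  then have m3: "integrable M (\<lambda>\<omega>. X0 \<omega> ^ 3 * exp (r * X0 \<omega>))"
    using X0_meas pos by (intro integrableI_nonneg) auto
  \<comment> \<open>The cubic moment implies the exponential one: below 1 the exponential is at most
    \<open>exp r\<close>, above 1 the cube is at least 1.\<close>
  have m0: "integrable M (\<lambda>\<omega>. exp (r * X0 \<omega>))"
  proof (rule Bochner_Integration.integrable_bound[OF Bochner_Integration.integrable_add[OF m3 integrable_const[of "exp r"]]])
    show "AE \<omega> in M. norm (exp (r * X0 \<omega>)) \<le> norm (X0 \<omega> ^ 3 * exp (r * X0 \<omega>) + exp r)"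
      using pos
    proof eventually_elim
      case (elim \<omega>)
      have "exp (r * X0 \<omega>) \<le> X0 \<omega> ^ 3 * exp (r * X0 \<omega>) + exp r"
      proof (cases "X0 \<omega> \<le> 1")
        case True
        then have "exp (r * X0 \<omega>) \<le> exp r" using r by (simp add: mult_left_le)
        moreover have "0 \<le> X0 \<omega> ^ 3 * exp (r * X0 \<omega>)" using elim by simp
        ultimately show ?thesis by linarith
      next
        case False
        then have "1 * exp (r * X0 \<omega>) \<le> X0 \<omega> ^ 3 * exp (r * X0 \<omega>)"
          by (intro mult_right_mono one_le_power) auto
        then show ?thesis by (simp add: add_increasing2)
      qed
      then show ?case using elim by simp
    qed
  qed (use X0_meas in simp)
  interpret yaglom_bm M B X0 r
    by unfold_locales (fact r BM X0_meas pos m0 indep m3)+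
  have X: "X = drifted_bm.X B X0 r"
    unfolding assms by (intro ext) (simp add: X_def)
  show ?thesis
    unfolding X by (intro conjI W1_asymptotics Liminf_le_Limsup) simp
qed

end
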